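(* Let $w$ be an $A_\infty$ weight on $\mathbb{R}^n$, let $p\ge 1$ and $s>1$, and let $a:\mathcal{Q}\to(0,\infty)$ be a functional satisfying the condition $SD^s_p(w)$ with constant $\|a\|$. Let $f$ be a locally integrable function such that $$\frac{1}{|Q|}\int_{Q}|f-f_Q|\,dx\le a(Q)$$ for every cube $Q$. Then there exists a constant $C_n$ depending only on the dimension $n$ such that for any cube $Q$ $$\left(\frac{1}{w(Q)}\int_Q|f-f_Q|^p\,w\,dx\right)^{1/p}\le C_n\,s\,\|a\|^s\,a(Q).$$
   Context: Cubes are cubes in $\mathbb{R}^n$ with sides parallel to the coordinate axes; $\mathcal{Q}$ is the family of all cubes. A weight is a locally integrable non-negative function; $w(E)=\int_E w\,dx$; $f_Q=\frac{1}{|Q|}\int_Q f\,dx$. $A_\infty=\bigcup_{p\ge1}A_p$ is the union of the Muckenhoupt classes (defined with cubes). For $L>1$ and a cube $Q$, a family $\{Q_i\}$ of pairwise disjoint subcubes of $Q$ is $L$-small, written $\{Q_i\}\in S(L)$, if $\sum_i|Q_i|\le |Q|/L$. For $s>1$, the functional $a$ satisfies $SD^s_p(w)$ if there is a constant $C$ such that for any $L>1$, any cube $Q$ and any family $\{Q_i\}$ of pairwise disjoint subcubes of $Q$ with $\{Q_i\}\in S(L)$, $$\sum_i a(Q_i)^p w(Q_i)\le C^p\left(\frac1L\right)^{p/s}a(Q)^p w(Q).$$ The best possible such $C$ is denoted $\|a\|$. *)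

theory Defs
  imports "HOL-Analysis.Analysis"
begin

text \<open>
  Cubes are half-open, so that dyadic subcubes of a cube are literally pairwise disjoint.
  (For closed cubes, disjointness would have to mean disjointness of the interiors.)
\<close>

definition cube :: "real ^ 'n \<Rightarrow> real \<Rightarrow> (real ^ 'n) set" where
  "cube c l = {x. \<forall>i. c $ i \<le> x $ i \<and> x $ i < c $ i + l}"

definition cubes :: "(real ^ 'n) set set" where
  "cubes = {cube c l | c l. l > 0}"

definition locally_integrable :: "(real ^ 'n \<Rightarrow> real) \<Rightarrow> bool" where
  "locally_integrable f \<longleftrightarrow> (\<forall>K. compact K \<longrightarrow> f absolutely_integrable_on K)"

definition avg :: "(real ^ 'n) set \<Rightarrow> (real ^ 'n \<Rightarrow> real) \<Rightarrow> real" where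
  "avg Q f = (1 / measure lebesgue Q) * (LINT x:Q|lebesgue. f x)"

definition weight :: "(real ^ 'n \<Rightarrow> real) \<Rightarrow> bool" where
  "weight w \<longleftrightarrow> locally_integrable w \<and> (\<forall>x. w x \<ge> 0)"

definition wmeasure :: "(real ^ 'n \<Rightarrow> real) \<Rightarrow> (real ^ 'n) set \<Rightarrow> real" where
  "wmeasure w E = (LINT x:E|lebesgue. w x)"

text \<open>
  The Muckenhoupt classes. For \<open>p > 1\<close> the exponent \<open>- 1 / (p - 1)\<close> is \<open>1 - p'\<close>.
  Since \<open>0 powr y = 0\<close> and since the Bochner integral of a non-integrable function is 0,
  the two requirements implicit in the finiteness of the \<open>A_p\<close> constant, namely that
  \<open>w\<close> is positive almost everywhere and that \<open>w\<close> to the power \<open>1 - p'\<close> is locally integrable,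
  are explicit here. The degenerate weight \<open>w = 0\<close> almost everywhere is thereby excluded.
\<close>

definition Muckenhoupt :: "real \<Rightarrow> (real ^ 'n \<Rightarrow> real) \<Rightarrow> bool" where
  "Muckenhoupt p w \<longleftrightarrow> weight w \<and> (AE x in lebesgue. w x > 0) \<and>
     (if p = 1
      then \<exists>C. \<forall>Q\<in>cubes. AE x in lebesgue. x \<in> Q \<longrightarrow> avg Q w \<le> C * w x
      else p > 1 \<and> locally_integrable (\<lambda>x. w x powr (- 1 / (p - 1))) \<and>
        (\<exists>C. \<forall>Q\<in>cubes. avg Q w * avg Q (\<lambda>x. w x powr (- 1 / (p - 1))) powr (p - 1) \<le> C))"

definition A_infinity :: "(real ^ 'n \<Rightarrow> real) \<Rightarrow> bool" where
  "A_infinity w \<longleftrightarrow> (\<exists>p\<ge>1. Muckenhoupt p w)"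

text \<open>
  Disjoint families of cubes are countable, possibly infinite. The explicit summability
  conditions rule out the value 0 that the infinite sum takes on non-summable families.
\<close>

definition small_family :: "real \<Rightarrow> (real ^ 'n) set \<Rightarrow> (real ^ 'n) set set \<Rightarrow> bool" where
  "small_family L Q F \<longleftrightarrow>
     F \<subseteq> cubes \<and> (\<forall>R\<in>F. R \<subseteq> Q) \<and> disjoint F \<and>
     (\<lambda>R. measure lebesgue R) summable_on F \<and>
     (\<Sum>\<^sub>\<infinity>R\<in>F. measure lebesgue R) \<le> measure lebesgue Q / L"

definition SD_bound ::
    "real \<Rightarrow> real \<Rightarrow> (real ^ 'n \<Rightarrow> real) \<Rightarrow> ((real ^ 'n) set \<Rightarrow> real) \<Rightarrow> real \<Rightarrow> bool" where
  "SD_bound p s w a C \<longleftrightarrow> C \<ge> 0 \<and>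
     (\<forall>L>1. \<forall>Q\<in>cubes. \<forall>F. small_family L Q F \<longrightarrow>
        (\<lambda>R. a R powr p * wmeasure w R) summable_on F \<and>
        (\<Sum>\<^sub>\<infinity>R\<in>F. a R powr p * wmeasure w R)
          \<le> C powr p * (1 / L) powr (p / s) * a Q powr p * wmeasure w Q)"

definition SD ::
    "real \<Rightarrow> real \<Rightarrow> (real ^ 'n \<Rightarrow> real) \<Rightarrow> ((real ^ 'n) set \<Rightarrow> real) \<Rightarrow> bool" where
  "SD p s w a \<longleftrightarrow> (\<exists>C. SD_bound p s w a C)"

definition SD_norm ::
    "real \<Rightarrow> real \<Rightarrow> (real ^ 'n \<Rightarrow> real) \<Rightarrow> ((real ^ 'n) set \<Rightarrow> real) \<Rightarrow> real" where
  "SD_norm p s w a = Inf {C. SD_bound p s w a C}"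

end

(*
  Iterating the Calderon-Zygmund decomposition at height e from Q gives generations of dyadic
  subcubes, the j-th of which is e^j-small in Q, and a.e. on Q
      |f - f_Q| <= 2^n e sum_j A_j,   A_j = sum over R in generation j of a(R) 1_R.
  With t = exp(-1/s), Jensen's inequality with the weights t^j (1 - t) bounds the p-th power of
  the sum by the sum of (t^j (1 - t))^(1-p) A_j^p, and the SD condition, applied with L = e^j
  directly to the j-th generation, bounds the w-integral of A_j^p by ||a||^p t^(jp) a(Q)^p w(Q).
  The resulting geometric series gives the constant 2^n e ||a|| / (1 - t) <= 2^(n+1) e s ||a||,
  which suffices because ||a|| >= 1.
*)
theory Submission
  imports Defs
begin

subsection \<open>Cubes\<close>

text \<open>The constant may depend on the dimension only, and the height of the decomposition
  enters it as a factor. Using the SD condition from parents to children would cost a factor ||a||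
  in each generation; convergence would then need ||a|| L^(-1/s) < 1, that is, a height above
  ||a||^s. This is a natural origin of the power ||a||^s in the statement. Seen from Q, a whole
  generation is a single e^j-small family, so ||a|| is paid once for each j and the height can stay
  at e. The ratio t = e^(-1/s) of the Jensen weights equals the decay rate of the L^p(w) norm of
  A_j. The outcome is the constant that Minkowski's inequality would give, the sum of ||a|| t^j, and
  no p survives the p-th root. All estimates are proved for an arbitrary admissible constant of the
  SD condition; the infimum is taken only at the end.\<close>

lemma cube_subset_cbox: "cube c l \<subseteq> cbox c (c + vec l)"
  by (auto simp: cube_def mem_box_cart less_imp_le)

lemma box_subset_cube: "box c (c + vec l) \<subseteq> cube c l"
  by (auto simp: cube_def mem_box_cart less_imp_le)

lemma cube_borel: "cube c l \<in> sets borel"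
proof -
  have "{x. \<forall>i. c $ i \<le> x $ i \<and> x $ i < c $ i + l} =
      (\<Inter>i. {x. c $ i \<le> x $ i} \<inter> {x. x $ i < c $ i + l})"
    by auto
  also have "\<dots> \<in> sets borel"
    by (intro sets.countable_INT' sets.Int borel_closed borel_open
        closed_Collect_le open_Collect_less continuous_intros) auto
  finally show ?thesis unfolding cube_def .
qed

lemma cube_lebesgue [measurable]: "cube c l \<in> sets lebesgue"
  using cube_borel[of c l] by (simp add: sets_completionI_sets)

text \<open>The half-open cube lies between the open and the closed box with the same corners, which
  have equal volume.\<close>

lemma emeasure_cube:
  fixes c :: "real ^ 'n"
  assumes "l \<ge> 0"
  shows "emeasure lebesgue (cube c l) = ennreal (l ^ CARD('n))"
proof (rule antisym)
  have le: "(\<forall>b\<in>Basis. c \<bullet> b \<le> (c + vec l) \<bullet> b)"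
    using assms by (auto simp: Basis_vec_def inner_axis)
  have pr: "(\<Prod>b\<in>Basis. (c + vec l - c) \<bullet> b) = l ^ CARD('n)"
    by (simp add: Basis_vec_def inner_axis prod.UNION_disjoint UNION_singleton_eq_range
        prod.reindex inj_on_def axis_eq_axis)
  show "emeasure lebesgue (cube c l) \<le> ennreal (l ^ CARD('n))"
    using emeasure_mono[OF cube_subset_cbox, of c l lebesgue] emeasure_lborel_cbox_eq[of c "c + vec l"] le pr
    by (simp add: inner_diff_left)
  show "ennreal (l ^ CARD('n)) \<le> emeasure lebesgue (cube c l)"
    using emeasure_mono[OF box_subset_cube, of c l lebesgue] emeasure_lborel_box_eq[of c "c + vec l"] le pr
    by (simp add: inner_diff_left)
qed

lemma measure_cube:
  fixes c :: "real ^ 'n"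
  assumes "l \<ge> 0"
  shows "measure lebesgue (cube c l) = l ^ CARD('n)"
  using emeasure_cube[OF assms, of c] assms by (simp add: measure_def)

lemma cubes_lebesgue [measurable_dest]: "Q \<in> cubes \<Longrightarrow> Q \<in> sets lebesgue"
  unfolding cubes_def by (auto intro: cube_lebesgue)

lemma cubes_emeasure: "Q \<in> cubes \<Longrightarrow> emeasure lebesgue Q = ennreal (measure lebesgue Q)"
  unfolding cubes_def by (auto simp: measure_cube emeasure_cube simp del: emeasure_completion)

lemma cubes_measure_pos: "Q \<in> cubes \<Longrightarrow> measure lebesgue Q > 0"
  unfolding cubes_def by (auto simp: measure_cube)

lemma locally_integrable_on_cube:
  assumes "locally_integrable f" "Q \<in> cubes"
  shows "set_integrable lebesgue Q f"
proof -
  obtain c l where Q: "Q = cube c l" using assms(2) by (auto simp: cubes_def)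
  have "f absolutely_integrable_on cbox c (c + vec l)"
    using assms(1) compact_cbox unfolding locally_integrable_def by blast
  then show ?thesis
    unfolding Q by (rule set_integrable_subset) (auto simp: cube_subset_cbox[THEN subsetD])
qed

subsection \<open>Dyadic subcubes and stopping families\<close>

text \<open>A cell is indexed by its level and any of its points, not by its integer corner. Its
  ancestors are then the cells of the same point at lower levels. The grid extends over the whole
  space.\<close>

definition dyadic :: "real ^ 'n \<Rightarrow> real \<Rightarrow> nat \<Rightarrow> real ^ 'n \<Rightarrow> (real ^ 'n) set" where
  "dyadic c l k x = cube (\<chi> i. c $ i + l / 2 ^ k * of_int \<lfloor>(x $ i - c $ i) * 2 ^ k / l\<rfloor>) (l / 2 ^ k)"

text \<open>Reduces nesting and disjointness of cells to arithmetic of floors.\<close>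

lemma mem_dyadic:
  assumes "l > 0"
  shows "y \<in> dyadic c l k x \<longleftrightarrow>
    (\<forall>i. \<lfloor>(y $ i - c $ i) * 2 ^ k / l\<rfloor> = \<lfloor>(x $ i - c $ i) * 2 ^ k / l\<rfloor>)"
proof -
  have "(c $ i + l / 2 ^ k * of_int z \<le> t \<and> t < c $ i + l / 2 ^ k * of_int z + l / 2 ^ k)
      \<longleftrightarrow> \<lfloor>(t - c $ i) * 2 ^ k / l\<rfloor> = z" for i t z
    using assms by (simp add: floor_eq_iff field_simps)
  then show ?thesis
    unfolding dyadic_def cube_def by simp
qed

lemma dyadic_self: "l > 0 \<Longrightarrow> x \<in> dyadic c l k x"
  by (simp add: mem_dyadic)

lemma dyadic_eq: "l > 0 \<Longrightarrow> y \<in> dyadic c l k x \<Longrightarrow> dyadic c l k y = dyadic c l k x"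
  using mem_dyadic[of l y c k x] by (simp add: dyadic_def)

lemma dyadic_in_cubes: "l > 0 \<Longrightarrow> dyadic c l k x \<in> cubes"
  unfolding dyadic_def cubes_def by fastforce

lemma measure_dyadic:
  fixes c :: "real ^ 'n"
  assumes "l > 0"
  shows "measure lebesgue (dyadic c l k x) = (l / 2 ^ k) ^ CARD('n)"
  unfolding dyadic_def using assms by (simp add: measure_cube)

lemma dyadic_0:
  assumes "l > 0" "x \<in> cube c l"
  shows "dyadic c l 0 x = cube c l"
proof -
  have "\<lfloor>(x $ i - c $ i) / l\<rfloor> = 0" for i
    using assms by (simp add: cube_def floor_eq_iff field_simps)
  then show ?thesis by (simp add: dyadic_def)
qed

text \<open>The grid coordinate at level \<open>k\<close> is the integer quotient by 2 of the one at
  level \<open>Suc k\<close>, so agreement at the finer level is inherited by the coarser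
  one.\<close>

lemma dyadic_Suc_subset:
  assumes "l > 0"
  shows "dyadic c l (Suc k) x \<subseteq> dyadic c l k x"
proof
  fix y assume y: "y \<in> dyadic c l (Suc k) x"
  have "\<lfloor>t * 2 ^ k / l\<rfloor> = \<lfloor>t * 2 ^ Suc k / l\<rfloor> div 2" for t
    using floor_divide_real_eq_div[of 2 "t * 2 ^ Suc k / l"] by simp
  then show "y \<in> dyadic c l k x"
    using y assms by (simp add: mem_dyadic)
qed

lemma dyadic_antimono:
  assumes "l > 0" "j \<le> k"
  shows "dyadic c l k x \<subseteq> dyadic c l j x"
  using assms(2) by (induction k rule: dec_induct) (use dyadic_Suc_subset[OF assms(1)] in blast)+

lemma dyadic_subset_cube:
  "l > 0 \<Longrightarrow> x \<in> cube c l \<Longrightarrow> dyadic c l k x \<subseteq> cube c l"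
  using dyadic_antimono[of l 0 k c x] dyadic_0[of l x c] by simp

lemma countable_dyadic:
  fixes c :: "real ^ 'n"
  shows "countable {dyadic c l k x | k x. True}"
proof -
  have "countable ((\<lambda>(k, z). cube (\<chi> i. c $ i + l / 2 ^ k * of_int (z $ i)) (l / 2 ^ k)) `
      (UNIV :: (nat \<times> (int ^ 'n)) set))"
    by (intro countable_image) auto
  moreover have "{dyadic c l k x | k x. True} \<subseteq>
      (\<lambda>(k, z). cube (\<chi> i. c $ i + l / 2 ^ k * of_int (z $ i)) (l / 2 ^ k)) ` (UNIV :: (nat \<times> (int ^ 'n)) set)"
  proof clarify
    fix k x
    show "dyadic c l k x \<in> (\<lambda>(k, z). cube (\<chi> i. c $ i + l / 2 ^ k * of_int (z $ i)) (l / 2 ^ k)) ` (UNIV :: (nat \<times> (int ^ 'n)) set)"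
      by (rule image_eqI[of _ _ "(k, \<chi> i. \<lfloor>(x $ i - c $ i) * 2 ^ k / l\<rfloor>)"])
        (simp_all add: dyadic_def)
  qed
  ultimately show ?thesis by (rule countable_subset[rotated])
qed

lemma dyadic_subset_open:
  fixes c :: "real ^ 'n"
  assumes "l > 0" "open U" "x \<in> U"
  shows "\<exists>k. dyadic c l k x \<subseteq> U"
proof -
  obtain e where e: "e > 0" "ball x e \<subseteq> U"
    using assms openE by blast
  \<comment> \<open>The factor \<open>CARD('n)\<close> is the price of bounding the Euclidean norm
    by the sum of the absolute values of the coordinates.\<close>
  have "(\<lambda>k. CARD('n) * (l / 2 ^ k)) \<longlonglongrightarrow> 0"
    using tendsto_mult_left[OF LIMSEQ_divide_realpow_zero[of 2 l], of "real CARD('n)"] by simp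
  then obtain k where k: "CARD('n) * (l / 2 ^ k) < e"
    using e(1) order_tendstoD(2)[of _ 0 sequentially e] eventually_happens'[OF sequentially_bot] by blast
  have "dyadic c l k x \<subseteq> ball x e"
  proof
    fix y assume y: "y \<in> dyadic c l k x"
    have "\<bar>(x - y) $ i\<bar> \<le> l / 2 ^ k" for i
    proof -
      have "x \<in> dyadic c l k x" by (rule dyadic_self[OF assms(1)])
      with y show ?thesis
        unfolding dyadic_def cube_def by (auto simp: abs_le_iff) (smt (verit))+
    qed
    then have "(\<Sum>i\<in>UNIV. \<bar>(x - y) $ i\<bar>) \<le> (\<Sum>i\<in>(UNIV :: 'n set). l / 2 ^ k)"
      by (intro sum_mono)
    then have "norm (x - y) \<le> CARD('n) * (l / 2 ^ k)"
      using norm_le_l1_cart[of "x - y"] by simp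
    then show "y \<in> ball x e" using k by (simp add: dist_norm)
  qed
  then show ?thesis using e by blast
qed

text \<open>The maximal dyadic subcubes satisfying \<open>P\<close>: the stopping-time form of the
  Calderon-Zygmund selection.\<close>

definition stopping :: "real ^ 'n \<Rightarrow> real \<Rightarrow> ((real ^ 'n) set \<Rightarrow> bool) \<Rightarrow> (real ^ 'n) set set" where
  "stopping c l P = {dyadic c l k x | k x.
     x \<in> cube c l \<and> P (dyadic c l k x) \<and> (\<forall>j<k. \<not> P (dyadic c l j x))}"

lemma countable_stopping: "countable (stopping c l P)"
  by (rule countable_subset[OF _ countable_dyadic[of c l]]) (auto simp: stopping_def)

lemma stopping_subset_cubes: "l > 0 \<Longrightarrow> stopping c l P \<subseteq> cubes"
  by (auto simp: stopping_def dyadic_in_cubes)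

lemma stopping_subset_cube: "l > 0 \<Longrightarrow> R \<in> stopping c l P \<Longrightarrow> R \<subseteq> cube c l"
  unfolding stopping_def using dyadic_subset_cube by blast

lemma stopping_holds: "R \<in> stopping c l P \<Longrightarrow> P R"
  by (auto simp: stopping_def)

text \<open>A common point has a single branch of cells, and the first level on it where
  \<open>P\<close> holds is unique.\<close>

lemma disjoint_stopping:
  assumes "l > 0"
  shows "disjoint (stopping c l P)"
proof (rule disjointI)
  fix R S assume R: "R \<in> stopping c l P" and S: "S \<in> stopping c l P" and ne: "R \<noteq> S"
  show "R \<inter> S = {}"
  proof (rule ccontr)
    assume "R \<inter> S \<noteq> {}"
    then obtain z where z: "z \<in> R" "z \<in> S" by blast
    obtain k x where k: "R = dyadic c l k x" "P R" "\<And>j. j < k \<Longrightarrow> \<not> P (dyadic c l j x)"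
      using R by (auto simp: stopping_def)
    obtain m y where m: "S = dyadic c l m y" "P S" "\<And>j. j < m \<Longrightarrow> \<not> P (dyadic c l j y)"
      using S by (auto simp: stopping_def)
    have kz: "dyadic c l j z = dyadic c l j x" if "j \<le> k" for j
      using z k(1) dyadic_antimono[OF assms that] by (intro dyadic_eq[OF assms]) auto
    have mz: "dyadic c l j z = dyadic c l j y" if "j \<le> m" for j
      using z m(1) dyadic_antimono[OF assms that] by (intro dyadic_eq[OF assms]) auto
    have "k = m"
      using k m kz mz by (metis le_refl less_imp_le linorder_neqE_nat)
    with kz mz k(1) m(1) ne show False by simp
  qed
qed

lemma Union_stopping:
  assumes "l > 0"
  shows "\<Union>(stopping c l P) = {x \<in> cube c l. \<exists>k. P (dyadic c l k x)}" (is "?A = ?B")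
proof
  show "?A \<subseteq> ?B"
  proof
    fix z assume "z \<in> ?A"
    then obtain R where R: "R \<in> stopping c l P" "z \<in> R" by blast
    then obtain k x where k: "R = dyadic c l k x" "P R" by (auto simp: stopping_def)
    then have "dyadic c l k z = R" using R dyadic_eq[OF assms] by blast
    then show "z \<in> ?B" using k R stopping_subset_cube[OF assms] by blast
  qed
  show "?B \<subseteq> ?A"
  proof
    fix x assume x: "x \<in> ?B"
    define k where "k = (LEAST k. P (dyadic c l k x))"
    have "P (dyadic c l k x)" using x LeastI_ex[of "\<lambda>k. P (dyadic c l k x)"] unfolding k_def by blast
    moreover have "\<not> P (dyadic c l j x)" if "j < k" for j
      using that not_less_Least unfolding k_def by blast
    ultimately have "dyadic c l k x \<in> stopping c l P" using x by (auto simp: stopping_def)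
    then show "x \<in> ?A" using dyadic_self[OF assms] by blast
  qed
qed

subsection \<open>Calderon--Zygmund decomposition\<close>

text \<open>Serves for two comparisons: the same cubes under two measures, and the selected children
  of each cube against the cube itself under one measure.\<close>

lemma emeasure_UN_le_cmult:
  assumes "countable I" "disjoint_family_on X I" "disjoint_family_on Y I"
    and "\<And>i. i \<in> I \<Longrightarrow> X i \<in> sets N" "\<And>i. i \<in> I \<Longrightarrow> Y i \<in> sets M"
    and "\<And>i. i \<in> I \<Longrightarrow> emeasure N (X i) \<le> r * emeasure M (Y i)"
  shows "emeasure N (\<Union>i\<in>I. X i) \<le> r * emeasure M (\<Union>i\<in>I. Y i)"
proof -
  have "emeasure N (\<Union>i\<in>I. X i) = (\<integral>\<^sup>+i. emeasure N (X i) \<partial>count_space I)"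
    using assms by (intro emeasure_UN_countable)
  also have "\<dots> \<le> (\<integral>\<^sup>+i. r * emeasure M (Y i) \<partial>count_space I)"
    using assms(6) by (intro nn_integral_mono) simp
  also have "\<dots> = r * (\<integral>\<^sup>+i. emeasure M (Y i) \<partial>count_space I)"
    by (intro nn_integral_cmult) simp
  also have "(\<integral>\<^sup>+i. emeasure M (Y i) \<partial>count_space I) = emeasure M (\<Union>i\<in>I. Y i)"
    using assms by (intro emeasure_UN_countable[symmetric])
  finally show ?thesis .
qed

lemma emeasure_Union_le_cmult:
  assumes "countable F" "disjoint F" "F \<subseteq> sets N" "F \<subseteq> sets M"
    and "\<And>R. R \<in> F \<Longrightarrow> emeasure N R \<le> r * emeasure M R"
  shows "emeasure N (\<Union>F) \<le> r * emeasure M (\<Union>F)"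
proof -
  have "disjoint_family_on (\<lambda>R. R) F"
    using assms(2) by (auto simp: disjoint_family_on_def disjoint_def)
  then have "emeasure N (\<Union>R\<in>F. R) \<le> r * emeasure M (\<Union>R\<in>F. R)"
    using assms by (intro emeasure_UN_le_cmult) auto
  then show ?thesis by simp
qed

section \<open>Averages over cubes\<close>

lemma set_integrable_const_cube: "R \<in> cubes \<Longrightarrow> set_integrable lebesgue R (\<lambda>x. t :: real)"
  using cubes_emeasure[of R] cubes_lebesgue[of R] by (auto simp: set_integrable_def)

lemma avg_const: "R \<in> cubes \<Longrightarrow> avg R (\<lambda>x. t) = t"
  using cubes_measure_pos[of R] cubes_lebesgue[of R] by (simp add: avg_def set_lebesgue_integral_def)

lemma avg_diff:
  assumes "set_integrable lebesgue R g" "set_integrable lebesgue R h"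
  shows "avg R (\<lambda>x. g x - h x) = avg R g - avg R h"
  unfolding avg_def using assms by (simp add: set_integral_diff right_diff_distrib)

lemma abs_avg_le:
  assumes "R \<in> cubes" "set_integrable lebesgue R g"
  shows "\<bar>avg R g\<bar> \<le> avg R (\<lambda>x. \<bar>g x\<bar>)"
proof -
  have "\<bar>LINT x:R|lebesgue. g x\<bar> \<le> (LINT x:R|lebesgue. \<bar>g x\<bar>)"
    using set_integral_norm_bound[OF assms(2)] by simp
  then show ?thesis
    unfolding avg_def using cubes_measure_pos[OF assms(1)]
    by (simp add: abs_mult divide_right_mono)
qed

lemma set_integrable_abs_diff:
  fixes f :: "real ^ 'n \<Rightarrow> real"
  assumes "R \<in> cubes" "set_integrable lebesgue R f"
  shows "set_integrable lebesgue R (\<lambda>x. \<bar>f x - t\<bar>)"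
  using assms set_integrable_const_cube[OF assms(1)]
  by (intro set_integrable_abs set_integral_diff) auto

lemma abs_avg_diff_le:
  assumes "R \<in> cubes" "set_integrable lebesgue R f"
  shows "\<bar>avg R f - t\<bar> \<le> avg R (\<lambda>x. \<bar>f x - t\<bar>)"
  using abs_avg_le[of R "\<lambda>x. f x - t"] avg_diff[of R f "\<lambda>x. t"] assms
    set_integrable_const_cube[OF assms(1)] avg_const[OF assms(1), of t]
  by (simp add: set_integral_diff)

text \<open>Turns inequalities between averages into inequalities between measures, which can be
  summed over disjoint cubes.\<close>

lemma emeasure_density_cube:
  fixes g :: "real ^ 'n \<Rightarrow> real"
  assumes "R \<in> cubes" "R \<subseteq> Q" "Q \<in> cubes" "set_integrable lebesgue Q g"
    and "\<And>x. x \<in> Q \<Longrightarrow> g x \<ge> 0"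
  shows "emeasure (density lebesgue (\<lambda>x. ennreal (indicator Q x * g x))) R
    = ennreal (avg R g) * emeasure lebesgue R"
proof -
  have R: "set_integrable lebesgue R g"
    using assms by (intro set_integrable_subset[OF assms(4)] cubes_lebesgue)
  have m: "(\<lambda>x. indicator Q x * g x) \<in> borel_measurable lebesgue"
    using assms(4) borel_measurable_integrable unfolding set_integrable_def by fastforce
  have "emeasure (density lebesgue (\<lambda>x. ennreal (indicator Q x * g x))) R
      = (\<integral>\<^sup>+x. ennreal (indicator Q x * g x) * indicator R x \<partial>lebesgue)"
    using m cubes_lebesgue[OF assms(1)] by (intro emeasure_density) auto
  also have "\<dots> = (\<integral>\<^sup>+x. ennreal (indicator R x * g x) \<partial>lebesgue)"
    using assms(2) by (intro nn_integral_cong) (auto simp: indicator_def)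
  also have "\<dots> = ennreal (LINT x:R|lebesgue. g x)"
    using R assms(2,5) unfolding set_integrable_def set_lebesgue_integral_def
    by (subst nn_integral_eq_integral) (auto simp: indicator_def)
  also have "(LINT x:R|lebesgue. g x) = avg R g * measure lebesgue R"
    using cubes_measure_pos[OF assms(1)] by (simp add: avg_def)
  also have "ennreal \<dots> = ennreal (avg R g) * emeasure lebesgue R"
    by (simp only: cubes_emeasure[OF assms(1)] ennreal_mult'' measure_nonneg)
  finally show ?thesis .
qed

text \<open>
  Covering a set by those dyadic cubes inside a nearby open set that meet it replaces
  the Lebesgue differentiation theorem.
\<close>

lemma AE_le_if_dyadic_avg_le:
  fixes g :: "real ^ 'n \<Rightarrow> real"
  assumes l: "l > 0" and int: "set_integrable lebesgue (cube c l) g"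
    and nonneg: "\<And>x. g x \<ge> 0" and t: "t \<ge> 0"
    and E: "E \<in> sets lebesgue" "E \<subseteq> cube c l"
    and le: "\<And>k x. x \<in> E \<Longrightarrow> avg (dyadic c l k x) g \<le> t"
  shows "AE x in lebesgue. x \<in> E \<longrightarrow> g x \<le> t"
proof -
  define Q where "Q = cube c l"
  have Q: "Q \<in> cubes" using l by (auto simp: Q_def cubes_def)
  define N where "N = density lebesgue (\<lambda>x. ennreal (indicator Q x * g x))"
  have m: "(\<lambda>x. indicator Q x * g x) \<in> borel_measurable lebesgue"
    using int borel_measurable_integrable unfolding set_integrable_def Q_def by fastforce
  have N_sets: "sets N = sets lebesgue" by (simp add: N_def)
  \<comment> \<open>The bad set. Since \<open>g\<close> exceeds \<open>t\<close> on it and its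
    volume is finite, it is null once its mass \<open>emeasure N B\<close> is at most
    \<open>t\<close> times its volume.\<close>
  define B where "B = {x \<in> space lebesgue. t < indicator Q x * g x} \<inter> E"
  have B: "B \<in> sets lebesgue"
    unfolding B_def using m[unfolded borel_measurable_iff_greater] E(1) by (intro sets.Int) auto
  have BE: "B \<subseteq> E" by (auto simp: B_def)
  have "emeasure lebesgue B \<le> emeasure lebesgue Q"
    using BE E(2) cubes_lebesgue[OF Q] by (intro emeasure_mono) (auto simp: Q_def)
  then have B_fin: "emeasure lebesgue B < top"
    unfolding cubes_emeasure[OF Q] using ennreal_less_top le_less_trans by blast
  have "emeasure N B \<le> ennreal t * emeasure lebesgue B + ennreal e" if e: "e > 0" for e
  proof -
    \<comment> \<open>Dividing by \<open>t + 1\<close> rather than \<open>t\<close> covers the case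
      \<open>t = 0\<close>.\<close>
    define d where "d = e / (t + 1)"
    have d: "d > 0" "t * d \<le> e" using e t by (auto simp: d_def field_simps)
    obtain U where U: "open U" "B \<subseteq> U" "U - B \<in> lmeasurable" "emeasure lebesgue (U - B) < ennreal d"
      using sets_lebesgue_outer_open[OF B d(1)] by blast
    \<comment> \<open>Meeting \<open>B\<close> makes each cube of \<open>V\<close> a dyadic cell of
      a point of \<open>E\<close>, so its average is at most \<open>t\<close>. Lying in
      \<open>U\<close> keeps the excess volume below \<open>d\<close>.\<close>
    define V where "V = stopping c l (\<lambda>R. R \<subseteq> U \<and> R \<inter> B \<noteq> {})"
    have V: "V \<subseteq> cubes" "countable V" "disjoint V" "\<And>R. R \<in> V \<Longrightarrow> R \<subseteq> Q"
      using stopping_subset_cubes[OF l] countable_stopping disjoint_stopping[OF l]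
        stopping_subset_cube[OF l] unfolding V_def Q_def by blast+
    have V_sets: "V \<subseteq> sets lebesgue" using V(1) cubes_lebesgue by blast
    have VU: "\<Union>V \<subseteq> U" using stopping_holds unfolding V_def by blast
    have BV: "B \<subseteq> \<Union>V"
    proof
      fix x assume x: "x \<in> B"
      obtain k where "dyadic c l k x \<subseteq> U" using dyadic_subset_open[OF l U(1)] x U(2) by blast
      moreover have "x \<in> cube c l" using x BE E(2) by blast
      ultimately show "x \<in> \<Union>V"
        unfolding V_def Union_stopping[OF l] using x dyadic_self[OF l, of x c k] by blast
    qed
    have avg: "avg R g \<le> t" if R: "R \<in> V" for R
    proof -
      obtain z where z: "z \<in> R" "z \<in> B" using stopping_holds R unfolding V_def by blast
      obtain k x where "R = dyadic c l k x" using R by (auto simp: V_def stopping_def)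
      then have "R = dyadic c l k z" using z dyadic_eq[OF l] by blast
      then show ?thesis using le z BE by blast
    qed
    have "emeasure N B \<le> emeasure N (\<Union>V)"
      using BV V_sets V(2) by (intro emeasure_mono) (auto simp: N_sets intro!: sets.countable_Union)
    also have "\<dots> \<le> ennreal t * emeasure lebesgue (\<Union>V)"
    proof (rule emeasure_Union_le_cmult)
      fix R assume R: "R \<in> V"
      have "emeasure N R = ennreal (avg R g) * emeasure lebesgue R"
        unfolding N_def using R V Q int nonneg by (intro emeasure_density_cube) (auto simp: Q_def)
      also have "\<dots> \<le> ennreal t * emeasure lebesgue R"
        using avg[OF R] by (intro mult_right_mono ennreal_leI) auto
      finally show "emeasure N R \<le> ennreal t * emeasure lebesgue R" .
    qed (use V V_sets in \<open>auto simp: N_sets\<close>)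
    also have "\<dots> \<le> ennreal t * (emeasure lebesgue B + emeasure lebesgue (U - B))"
    proof (intro mult_left_mono)
      have "emeasure lebesgue (\<Union>V) \<le> emeasure lebesgue (B \<union> (U - B))"
        using VU B U(3) by (intro emeasure_mono sets.Un) (auto simp: fmeasurable_def)
      also have "\<dots> = emeasure lebesgue B + emeasure lebesgue (U - B)"
        using B U(3) by (intro plus_emeasure[symmetric]) (auto simp: fmeasurable_def)
      finally show "emeasure lebesgue (\<Union>V) \<le> emeasure lebesgue B + emeasure lebesgue (U - B)" .
    qed simp
    also have "\<dots> \<le> ennreal t * (emeasure lebesgue B + ennreal d)"
      using U(4) by (intro mult_left_mono add_left_mono) auto
    also have "\<dots> \<le> ennreal t * emeasure lebesgue B + ennreal e"
      using d t by (auto simp: distrib_left ennreal_mult[symmetric] intro!: add_left_mono ennreal_leI)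
    finally show ?thesis .
  qed
  then have N_B: "emeasure N B \<le> ennreal t * emeasure lebesgue B"
    by (rule ennreal_le_epsilon)
  \<comment> \<open>The excess of \<open>g\<close> over \<open>t\<close> is split off additively so
    that the integral of \<open>t\<close> over \<open>B\<close>, finite by \<open>B_fin\<close>, can
    be cancelled.\<close>
  have split: "ennreal (indicator Q x * g x) * indicator B x
      = ennreal (indicator Q x * g x - t) * indicator B x + ennreal t * indicator B x" for x
  proof (cases "x \<in> B")
    case True
    then have "t < indicator Q x * g x" by (simp add: B_def)
    then show ?thesis
      using True t ennreal_plus[of "indicator Q x * g x - t" t] by simp
  qed simp
  have "emeasure N B = (\<integral>\<^sup>+x. ennreal (indicator Q x * g x) * indicator B x \<partial>lebesgue)"
    unfolding N_def using m B by (intro emeasure_density) auto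
  also have "\<dots> = (\<integral>\<^sup>+x. ennreal (indicator Q x * g x - t) * indicator B x + ennreal t * indicator B x \<partial>lebesgue)"
    by (rule nn_integral_cong) (rule split)
  also have "\<dots> = (\<integral>\<^sup>+x. ennreal (indicator Q x * g x - t) * indicator B x \<partial>lebesgue)
      + (\<integral>\<^sup>+x. ennreal t * indicator B x \<partial>lebesgue)"
    using m B by (intro nn_integral_add borel_measurable_times measurable_compose[OF _ measurable_ennreal]
        borel_measurable_diff borel_measurable_indicator) auto
  also have "(\<integral>\<^sup>+x. ennreal t * indicator B x \<partial>lebesgue) = ennreal t * emeasure lebesgue B"
    using B by (rule nn_integral_cmult_indicator)
  finally have "(\<integral>\<^sup>+x. ennreal (indicator Q x * g x - t) * indicator B x \<partial>lebesgue)
      + ennreal t * emeasure lebesgue B \<le> 0 + ennreal t * emeasure lebesgue B"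
    using N_B by simp
  then have "(\<integral>\<^sup>+x. ennreal (indicator Q x * g x - t) * indicator B x \<partial>lebesgue) \<le> 0"
    using B_fin ennreal_add_left_cancel_le[of "ennreal t * emeasure lebesgue B"]
    by (auto simp: add.commute ennreal_mult_eq_top_iff simp del: emeasure_completion)
  then have "AE x in lebesgue. ennreal (indicator Q x * g x - t) * indicator B x = 0"
    using m B by (subst nn_integral_0_iff_AE[symmetric])
      (auto intro!: borel_measurable_times measurable_compose[OF _ measurable_ennreal]
        borel_measurable_diff borel_measurable_indicator)
  then show ?thesis
  proof eventually_elim
    case (elim x)
    show ?case
    proof (intro impI, rule ccontr)
      assume x: "x \<in> E" "\<not> g x \<le> t"
      then have "x \<in> Q" using E(2) by (auto simp: Q_def)
      then show False using x elim by (simp add: B_def)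
    qed
  qed
qed

text \<open>Selected are the maximal dyadic subcubes on which the average of |f - f_Q| exceeds
  \<open>L * A\<close>. The bound on the jump of averages comes from the unselected parent, the
  volume bound from Chebyshev's inequality, and the bound off the selected cubes from
  \<open>AE_le_if_dyadic_avg_le\<close>.\<close>

lemma calderon_zygmund:
  fixes f :: "real ^ 'n \<Rightarrow> real"
  assumes Q: "Q \<in> cubes" and int: "set_integrable lebesgue Q f"
    and A: "avg Q (\<lambda>x. \<bar>f x - avg Q f\<bar>) \<le> A" "A > 0" and L: "L \<ge> 1"
  shows "\<exists>F\<subseteq>cubes. countable F \<and> disjoint F \<and> (\<forall>R\<in>F. R \<subseteq> Q) \<and>
    (\<forall>R\<in>F. \<bar>avg R f - avg Q f\<bar> \<le> 2 ^ CARD('n) * L * A) \<and>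
    emeasure lebesgue (\<Union>F) \<le> ennreal (1 / L) * emeasure lebesgue Q \<and>
    (AE x in lebesgue. x \<in> Q \<longrightarrow> x \<notin> \<Union>F \<longrightarrow> \<bar>f x - avg Q f\<bar> \<le> L * A)"
proof -
  obtain c l where cl: "Q = cube c l" "l > 0" using Q by (auto simp: cubes_def)
  define g where "g = (\<lambda>x. \<bar>f x - avg Q f\<bar>)"
  define F where "F = stopping c l (\<lambda>R. L * A < avg R g)"
  define N where "N = density lebesgue (\<lambda>x. ennreal (indicator Q x * g x))"
  have g: "set_integrable lebesgue Q g" unfolding g_def by (rule set_integrable_abs_diff[OF Q int])
  have g0: "g x \<ge> 0" for x by (simp add: g_def)
  have AL: "A \<le> L * A" "L * A > 0" using A(2) L by auto
  have F: "F \<subseteq> cubes" "countable F" "disjoint F" "\<And>R. R \<in> F \<Longrightarrow> R \<subseteq> Q"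
    using stopping_subset_cubes[OF cl(2)] countable_stopping disjoint_stopping[OF cl(2)]
      stopping_subset_cube[OF cl(2)] unfolding F_def cl(1) by blast+
  have F_sets: "F \<subseteq> sets lebesgue" using F(1) cubes_lebesgue by blast
  have UF: "\<Union>F \<in> sets lebesgue" using F(2) F_sets by (intro sets.countable_Union) auto
  have dens: "emeasure N R = ennreal (avg R g) * emeasure lebesgue R" if "R \<in> cubes" "R \<subseteq> Q" for R
    unfolding N_def using that Q g g0 by (intro emeasure_density_cube)
  have "\<bar>avg R f - avg Q f\<bar> \<le> 2 ^ CARD('n) * L * A" if R: "R \<in> F" for R
  proof -
    obtain k x where k: "R = dyadic c l k x" "x \<in> cube c l" "L * A < avg R g"
        "\<And>j. j < k \<Longrightarrow> avg (dyadic c l j x) g \<le> L * A"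
      using R unfolding F_def stopping_def by (auto simp: not_less)
    \<comment> \<open>As \<open>L \<ge> 1\<close>, the cube \<open>Q\<close> itself is not selected,
      so every selected cube has a parent inside \<open>Q\<close>.\<close>
    have "avg Q g \<le> L * A"
      using A(1) AL(1) by (simp add: g_def)
    then have "k \<noteq> 0"
      using k(1,2,3) dyadic_0[OF cl(2) k(2)] cl(1) by (metis not_le)
    then obtain j where j: "k = Suc j" using not0_implies_Suc by blast
    define P where "P = dyadic c l j x"
    have P: "P \<in> cubes" "P \<subseteq> Q" "R \<subseteq> P" "avg P g \<le> L * A"
      using dyadic_in_cubes[OF cl(2)] dyadic_subset_cube[OF cl(2) k(2)] dyadic_Suc_subset[OF cl(2)] k j cl(1)
      by (simp_all add: P_def)
    have Rc: "R \<in> cubes" "R \<subseteq> Q" using R F by auto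
    have mP: "measure lebesgue P = 2 ^ CARD('n) * measure lebesgue R"
      using cl(2) unfolding P_def k(1) j by (simp add: measure_dyadic power_divide power_mult_distrib)
    have gP: "set_integrable lebesgue P g"
      using P cubes_lebesgue by (intro set_integrable_subset[OF g]) auto
    have "(LINT x:R|lebesgue. g x) \<le> (LINT x:P|lebesgue. g x)"
      using gP P(3) g0 set_integrable_subset[OF gP cubes_lebesgue[OF Rc(1)] P(3)]
      unfolding set_lebesgue_integral_def set_integrable_def
      by (intro integral_mono) (auto simp: indicator_def)
    then have "avg R g * measure lebesgue R \<le> avg P g * measure lebesgue P"
      using cubes_measure_pos[OF Rc(1)] cubes_measure_pos[OF P(1)] by (simp add: avg_def)
    then have "avg R g \<le> avg P g * 2 ^ CARD('n)"
      using cubes_measure_pos[OF Rc(1)] by (simp add: mP)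
    also have "\<dots> \<le> L * A * 2 ^ CARD('n)"
      using P(4) by (intro mult_right_mono) auto
    finally have "avg R g \<le> 2 ^ CARD('n) * L * A" by (simp add: mult_ac)
    moreover have "\<bar>avg R f - avg Q f\<bar> \<le> avg R g"
      unfolding g_def using Rc cubes_lebesgue by (intro abs_avg_diff_le set_integrable_subset[OF int]) auto
    ultimately show ?thesis by simp
  qed
  moreover have "emeasure lebesgue (\<Union>F) \<le> ennreal (1 / L) * emeasure lebesgue Q"
  proof -
    \<comment> \<open>Chebyshev: each selected cube carries \<open>N\<close>-mass at least
      \<open>L * A\<close> times its volume, while \<open>Q\<close> has \<open>N\<close>-mass at
      most \<open>A\<close> times its volume.\<close>
    have "emeasure lebesgue (\<Union>F) \<le> ennreal (1 / (L * A)) * emeasure N (\<Union>F)"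
    proof (rule emeasure_Union_le_cmult)
      fix R assume R: "R \<in> F"
      have "L * A \<le> avg R g" using R stopping_holds unfolding F_def by (blast intro: less_imp_le)
      then have "1 \<le> 1 / (L * A) * avg R g" using AL by (simp add: field_simps)
      then have "ennreal 1 \<le> ennreal (1 / (L * A)) * ennreal (avg R g)"
        using AL by (subst ennreal_mult'[symmetric]) (auto intro: ennreal_leI)
      then have "ennreal 1 * emeasure lebesgue R \<le> ennreal (1 / (L * A)) * ennreal (avg R g) * emeasure lebesgue R"
        by (intro mult_right_mono) auto
      then show "emeasure lebesgue R \<le> ennreal (1 / (L * A)) * emeasure N R"
        using R F dens by (auto simp: mult.assoc)
    qed (use F F_sets in \<open>auto simp: N_def\<close>)
    also have "\<dots> \<le> ennreal (1 / (L * A)) * emeasure N Q"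
      using F(4) cubes_lebesgue[OF Q] by (intro mult_left_mono emeasure_mono) (auto simp: N_def)
    also have "\<dots> \<le> ennreal (1 / (L * A)) * (ennreal A * emeasure lebesgue Q)"
      using A(1) dens[OF Q] by (auto simp: g_def intro!: mult_left_mono mult_right_mono ennreal_leI)
    also have "\<dots> = ennreal (1 / L) * emeasure lebesgue Q"
      using A(2) AL by (simp add: mult.assoc[symmetric] ennreal_mult'[symmetric])
    finally show ?thesis .
  qed
  moreover have "AE x in lebesgue. x \<in> Q - \<Union>F \<longrightarrow> g x \<le> L * A"
  proof (rule AE_le_if_dyadic_avg_le[OF cl(2)])
    show "Q - \<Union>F \<in> sets lebesgue" using UF cubes_lebesgue[OF Q] by auto
    show "avg (dyadic c l k x) g \<le> L * A" if "x \<in> Q - \<Union>F" for k x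
      using that unfolding F_def Union_stopping[OF cl(2)] by (auto simp: cl(1) not_less)
  qed (use g g0 AL cl(1) in auto)
  ultimately show ?thesis
    using F unfolding g_def by (intro exI[of _ F]) (auto elim!: AE_mp)
qed

subsection \<open>Iterated selection of subcubes\<close>

text \<open>Finite partial sums are volumes of disjoint unions. Their common bound gives both the
  summability and the value that \<open>small_family\<close> requires.\<close>

lemma small_familyI:
  assumes Q: "Q \<in> cubes" and F: "F \<subseteq> cubes" "countable F" "disjoint F" "\<And>R. R \<in> F \<Longrightarrow> R \<subseteq> Q"
    and L: "L > 0" and le: "emeasure lebesgue (\<Union>F) \<le> ennreal (1 / L) * emeasure lebesgue Q"
  shows "small_family L Q F"
proof -
  have "sum (measure lebesgue) G \<le> measure lebesgue Q / L" if G: "finite G" "G \<subseteq> F" for G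
  proof -
    have Gc: "G \<subseteq> cubes" "disjoint G" using G F pairwise_subset by blast+
    have sets: "F \<subseteq> sets lebesgue" using F(1) cubes_lebesgue by blast
    have "ennreal (sum (measure lebesgue) G) = (\<Sum>R\<in>G. ennreal (measure lebesgue R))"
      by (rule sum_ennreal[symmetric]) simp
    also have "\<dots> = (\<Sum>R\<in>G. emeasure lebesgue R)"
      using Gc by (intro sum.cong refl cubes_emeasure[symmetric]) blast
    also have "\<dots> = emeasure lebesgue (\<Union>R\<in>G. R)"
      using Gc(2) G sets by (intro sum_emeasure) (auto simp: disjoint_family_on_def disjoint_def)
    also have "\<dots> \<le> emeasure lebesgue (\<Union>F)"
      using G sets F(2) by (intro emeasure_mono sets.countable_Union) auto
    also have "\<dots> \<le> ennreal (1 / L) * ennreal (measure lebesgue Q)"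
      using le unfolding cubes_emeasure[OF Q] .
    also have "\<dots> = ennreal (measure lebesgue Q / L)"
      using L by (simp add: ennreal_mult'[symmetric])
    finally show ?thesis
      using L by (subst (asm) ennreal_le_iff) auto
  qed
  then have fin: "\<And>G. finite G \<Longrightarrow> G \<subseteq> F \<Longrightarrow> sum (measure lebesgue) G \<le> measure lebesgue Q / L" .
  have "measure lebesgue summable_on F"
    by (rule nonneg_bdd_above_summable_on) (use fin in \<open>auto intro!: bdd_aboveI2\<close>)
  moreover from this have "infsum (measure lebesgue) F \<le> measure lebesgue Q / L"
    using fin by (rule infsum_le_finite_sums)
  ultimately show ?thesis
    unfolding small_family_def using F by blast
qed

primrec generation :: "('b set \<Rightarrow> 'b set set) \<Rightarrow> 'b set \<Rightarrow> nat \<Rightarrow> 'b set set" where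
  "generation F Q 0 = {Q}"
| "generation F Q (Suc k) = (\<Union>R\<in>generation F Q k. F R)"

text \<open>The iteration uses only the geometry of the selection; \<open>f\<close> and
  \<open>a\<close> return with the weighted estimate.\<close>

locale cube_selection =
  fixes F :: "(real ^ 'n) set \<Rightarrow> (real ^ 'n) set set" and L :: real
  assumes L: "L > 1"
    and F_cubes: "Q \<in> cubes \<Longrightarrow> F Q \<subseteq> cubes"
    and countable_F: "Q \<in> cubes \<Longrightarrow> countable (F Q)"
    and disjoint_F: "Q \<in> cubes \<Longrightarrow> disjoint (F Q)"
    and F_subset: "Q \<in> cubes \<Longrightarrow> R \<in> F Q \<Longrightarrow> R \<subseteq> Q"
    and emeasure_F: "Q \<in> cubes \<Longrightarrow> emeasure lebesgue (\<Union>(F Q)) \<le> ennreal (1 / L) * emeasure lebesgue Q"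
begin

lemma generation_cubes: "Q \<in> cubes \<Longrightarrow> generation F Q k \<subseteq> cubes"
  by (induction k) (use F_cubes in auto)

lemma generation_sets: "Q \<in> cubes \<Longrightarrow> generation F Q k \<subseteq> sets lebesgue"
  using generation_cubes cubes_lebesgue by blast

lemma countable_generation: "Q \<in> cubes \<Longrightarrow> countable (generation F Q k)"
proof (induction k)
  case (Suc k)
  then show ?case using countable_F generation_cubes[OF Suc.prems, of k] by auto
qed simp

lemma generation_subset: "Q \<in> cubes \<Longrightarrow> R \<in> generation F Q k \<Longrightarrow> R \<subseteq> Q"
proof (induction k arbitrary: R)
  case (Suc k)
  then obtain S where S: "S \<in> generation F Q k" "R \<in> F S" by auto
  then have "R \<subseteq> S" "S \<subseteq> Q"
    using Suc F_subset generation_cubes by blast+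
  then show ?case by blast
qed simp

lemma disjoint_generation: "Q \<in> cubes \<Longrightarrow> disjoint (generation F Q k)"
proof (induction k)
  case (Suc k)
  show ?case
  proof (rule disjointI)
    fix R R' assume R: "R \<in> generation F Q (Suc k)" and R': "R' \<in> generation F Q (Suc k)" and ne: "R \<noteq> R'"
    obtain S where S: "S \<in> generation F Q k" "R \<in> F S" using R by auto
    obtain S' where S': "S' \<in> generation F Q k" "R' \<in> F S'" using R' by auto
    have c: "S \<in> cubes" "S' \<in> cubes" using S S' generation_cubes[OF Suc.prems] by blast+
    show "R \<inter> R' = {}"
    proof (cases "S = S'")
      case True
      then show ?thesis using S S' ne disjoint_F[OF c(1)] by (auto dest: disjointD)
    next
      case False
      then have "S \<inter> S' = {}" using S S' Suc.IH[OF Suc.prems] by (auto dest: disjointD)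
      then show ?thesis using F_subset[OF c(1) S(2)] F_subset[OF c(2) S'(2)] by blast
    qed
  qed
qed simp

text \<open>Disjointness of generation \<open>k\<close> makes \<open>R\<close> the only possible
  parent of \<open>S\<close>. Cubes of successive generations through one point therefore form a
  chain of parents and children.\<close>

lemma generation_child:
  assumes "Q \<in> cubes" "R \<in> generation F Q k" "S \<in> generation F Q (Suc k)" "x \<in> R" "x \<in> S"
  shows "S \<in> F R"
proof -
  obtain R' where R': "R' \<in> generation F Q k" "S \<in> F R'" using assms(3) by auto
  have "S \<subseteq> R'" using R' F_subset generation_cubes[OF assms(1)] by blast
  then have "R = R'"
    using disjoint_generation[OF assms(1), of k] R' assms by (auto dest: disjointD)
  with R' show ?thesis by simp
qed

lemma emeasure_generation:
  assumes Q: "Q \<in> cubes"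
  shows "emeasure lebesgue (\<Union>(generation F Q k)) \<le> ennreal (1 / L ^ k) * emeasure lebesgue Q"
proof (induction k)
  case (Suc k)
  have c: "R \<in> cubes" if "R \<in> generation F Q k" for R
    using that generation_cubes[OF Q] by blast
  have disj: "disjoint_family_on (\<lambda>R. R) (generation F Q k)"
    using disjoint_generation[OF Q, of k] by (auto simp: disjoint_family_on_def disjoint_def)
  have sub: "\<Union>(F R) \<subseteq> R" if "R \<in> generation F Q k" for R
    using F_subset[OF c[OF that]] by blast
  have disj': "disjoint_family_on (\<lambda>R. \<Union>(F R)) (generation F Q k)"
    unfolding disjoint_family_on_def
  proof (intro ballI impI)
    fix R S assume "R \<in> generation F Q k" "S \<in> generation F Q k" "R \<noteq> S"
    then have "R \<inter> S = {}" "\<Union>(F R) \<subseteq> R" "\<Union>(F S) \<subseteq> S"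
      using disj sub unfolding disjoint_family_on_def by blast+
    then show "\<Union>(F R) \<inter> \<Union>(F S) = {}" by blast
  qed
  have "emeasure lebesgue (\<Union>R\<in>generation F Q k. \<Union>(F R))
      \<le> ennreal (1 / L) * emeasure lebesgue (\<Union>R\<in>generation F Q k. R)"
  \<comment> \<open>Each parent is compared with the union of its own children; both families are
    disjoint, so the factor \<open>1 / L\<close> of a single selection carries over to the
    unions.\<close>
  proof (rule emeasure_UN_le_cmult[OF countable_generation[OF Q] disj' disj])
    show "\<Union>(F R) \<in> sets lebesgue" if "R \<in> generation F Q k" for R
      using F_cubes[OF c[OF that]] countable_F[OF c[OF that]] cubes_lebesgue
      by (intro sets.countable_Union) auto
  qed (use c cubes_lebesgue emeasure_F in blast)+
  also have "\<dots> \<le> ennreal (1 / L) * (ennreal (1 / L ^ k) * emeasure lebesgue Q)"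
    using Suc.IH by (intro mult_left_mono) auto
  also have "\<dots> = ennreal (1 / L ^ Suc k) * emeasure lebesgue Q"
    using L by (simp add: mult.assoc[symmetric] ennreal_mult'[symmetric])
  also have "(\<Union>R\<in>generation F Q k. \<Union>(F R)) = \<Union>(generation F Q (Suc k))"
    by auto
  finally show ?case .
qed simp

lemma small_family_generation:
  "Q \<in> cubes \<Longrightarrow> small_family (L ^ k) Q (generation F Q k)"
  using L by (intro small_familyI generation_cubes countable_generation disjoint_generation
      generation_subset emeasure_generation) auto

text \<open>The volume of generation \<open>k\<close> tends to 0. This is what makes the chain of
  selected cubes through almost every point finite.\<close>

lemma AE_not_in_all_generations:
  assumes Q: "Q \<in> cubes"
  shows "AE x in lebesgue. \<exists>k. x \<notin> \<Union>(generation F Q k)"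
proof -
  let ?N = "\<Inter>k. \<Union>(generation F Q k)"
  have N: "?N \<in> sets lebesgue"
    using countable_generation[OF Q] generation_sets[OF Q]
    by (intro sets.countable_INT' sets.countable_Union) auto
  have le: "emeasure lebesgue ?N \<le> ennreal ((1 / L) ^ k * measure lebesgue Q)" for k
  proof -
    have "emeasure lebesgue ?N \<le> emeasure lebesgue (\<Union>(generation F Q k))"
      using countable_generation[OF Q] generation_sets[OF Q]
      by (intro emeasure_mono sets.countable_Union) auto
    also have "\<dots> \<le> ennreal (1 / L ^ k) * ennreal (measure lebesgue Q)"
      using emeasure_generation[OF Q, of k] unfolding cubes_emeasure[OF Q] .
    also have "\<dots> = ennreal ((1 / L) ^ k * measure lebesgue Q)"
      using L by (simp add: ennreal_mult'[symmetric] power_one_over)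
    finally show ?thesis .
  qed
  have "(\<lambda>k. (1 / L) ^ k * measure lebesgue Q) \<longlonglongrightarrow> 0 * measure lebesgue Q"
    using L by (intro tendsto_intros LIMSEQ_realpow_zero) auto
  then have "(\<lambda>k. ennreal ((1 / L) ^ k * measure lebesgue Q)) \<longlonglongrightarrow> ennreal 0"
    by (intro tendsto_ennrealI) simp
  then have "emeasure lebesgue ?N \<le> ennreal 0"
    by (rule LIMSEQ_le_const) (use le in blast)
  then have "?N \<in> null_sets lebesgue"
    using N by (intro null_setsI) auto
  then have "AE x in lebesgue. x \<notin> ?N" by (rule AE_not_in)
  then show ?thesis by eventually_elim blast
qed

lemma generation_chain:
  assumes Q: "Q \<in> cubes" and x: "x \<in> Q" "x \<notin> \<Union>(generation F Q k)"
  obtains m r where "r 0 = Q" "\<And>j. j \<le> m \<Longrightarrow> r j \<in> generation F Q j"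
    "\<And>j. j < m \<Longrightarrow> r (Suc j) \<in> F (r j)" "\<And>j. j \<le> m \<Longrightarrow> x \<in> r j" "x \<notin> \<Union>(F (r m))"
proof -
  define M where "M = (LEAST k. x \<notin> \<Union>(generation F Q k))"
  have M: "x \<notin> \<Union>(generation F Q M)" unfolding M_def using x(2) by (rule LeastI[of "\<lambda>k. x \<notin> \<Union>(generation F Q k)"])
  \<comment> \<open>Generation 0 is \<open>{Q}\<close> and contains \<open>x\<close>, so the first
    generation missing \<open>x\<close> has a predecessor \<open>m\<close>, where the chain
    ends.\<close>
  then have "M \<noteq> 0" using x(1) by (cases M) auto
  then obtain m where m: "M = Suc m" using not0_implies_Suc by blast
  have "x \<in> \<Union>(generation F Q j)" if "j \<le> m" for j
    using not_less_Least[of j "\<lambda>k. x \<notin> \<Union>(generation F Q k)"] that m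
    unfolding M_def[symmetric] by simp
  then have "\<exists>R. j \<le> m \<longrightarrow> R \<in> generation F Q j \<and> x \<in> R" for j
    by blast
  then obtain r where r: "\<And>j. j \<le> m \<Longrightarrow> r j \<in> generation F Q j \<and> x \<in> r j" by metis
  show thesis
  proof (rule that[of r m])
    show "r 0 = Q" using r[of 0] by simp
    show "r (Suc j) \<in> F (r j)" if "j < m" for j
      using generation_child[OF Q, of "r j" j "r (Suc j)" x] r[of j] r[of "Suc j"] that by simp
    show "x \<notin> \<Union>(F (r m))" using M r[of m] unfolding m by auto
  qed (use r in auto)
qed

end

subsection \<open>The weighted estimate\<close>

text \<open>Convexity of the p-th power at the points x / (1 - t) and y / t with weights 1 - t and
  t.\<close>

lemma powr_add_le_weighted:
  fixes x y t p :: real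
  assumes "x > 0" "y > 0" "0 < t" "t < 1" "p \<ge> 1"
  shows "(x + y) powr p \<le> (1 - t) powr (1 - p) * x powr p + t powr (1 - p) * y powr p"
proof -
  have eq: "u * (z / u) powr p = u powr (1 - p) * z powr p" if "u > 0" "z > 0" for u z :: real
    using that by (simp add: powr_divide powr_diff)
  have "((1 - t) *\<^sub>R (x / (1 - t)) + t *\<^sub>R (y / t)) powr p
      \<le> (1 - t) * (x / (1 - t)) powr p + t * (y / t) powr p"
    using assms by (intro convex_onD[OF powr_convex[OF assms(5)]]) auto
  then show ?thesis using assms by (simp add: eq)
qed

text \<open>Splitting off \<open>b 0\<close> with weight \<open>1 - t\<close> leaves the tail with
  weight \<open>t\<close>, which raises the powers of \<open>t\<close> in the inner weights by one.
  The weights do not depend on \<open>m\<close>, so chains of every length obey the same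
  inequality.\<close>

lemma powr_sum_le_geometric:
  fixes b :: "nat \<Rightarrow> real"
  assumes "0 < t" "t < 1" "p \<ge> 1" "\<And>j. j \<le> m \<Longrightarrow> b j > 0"
  shows "(\<Sum>j\<le>m. b j) powr p \<le> (\<Sum>j\<le>m. (t ^ j * (1 - t)) powr (1 - p) * b j powr p)"
  using assms(4)
proof (induction m arbitrary: b)
  case 0
  \<comment> \<open>The base is below 1 and the exponent \<open>1 - p\<close> is at most 0, so the
    weight of a single term only adds slack.\<close>
  have "1 \<le> (1 - t) powr (1 - p)"
    using assms powr_mono_both'[of "1 - p" 0 "1 - t" 1] powr_mono'[of "1 - p" 0 "1 - t"] by simp
  then show ?case using mult_right_mono[of 1 _ "b 0 powr p"] by simp
next
  case (Suc m)
  have "(\<Sum>j\<le>Suc m. b j) powr p = (b 0 + (\<Sum>j\<le>m. b (Suc j))) powr p"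
    by (simp only: sum.atMost_Suc_shift)
  also have "\<dots> \<le> (1 - t) powr (1 - p) * b 0 powr p + t powr (1 - p) * (\<Sum>j\<le>m. b (Suc j)) powr p"
    using assms Suc.prems by (intro powr_add_le_weighted sum_pos) auto
  also have "\<dots> \<le> (1 - t) powr (1 - p) * b 0 powr p
      + t powr (1 - p) * (\<Sum>j\<le>m. (t ^ j * (1 - t)) powr (1 - p) * b (Suc j) powr p)"
    using Suc.prems by (intro add_left_mono mult_left_mono Suc.IH) auto
  also have "\<dots> = (\<Sum>j\<le>Suc m. (t ^ j * (1 - t)) powr (1 - p) * b j powr p)"
    using assms unfolding sum.atMost_Suc_shift
    by (simp add: sum_distrib_left powr_mult mult_ac)
  finally show ?case .
qed

section \<open>Sums over countable families and the SD condition\<close>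

lemma nn_integral_count_space_ge:
  fixes g :: "'b \<Rightarrow> ennreal"
  assumes "i \<in> I"
  shows "g i \<le> (\<integral>\<^sup>+i. g i \<partial>count_space I)"
proof -
  have "g i = (\<integral>\<^sup>+j. g j * indicator {i} j \<partial>count_space I)"
    using assms by (subst nn_integral_count_space'[of "{i}"]) auto
  also have "\<dots> \<le> (\<integral>\<^sup>+j. g j \<partial>count_space I)"
    by (intro nn_integral_mono) (auto simp: indicator_def)
  finally show ?thesis .
qed

lemma borel_measurable_nn_integral_count_space:
  fixes g :: "'b \<Rightarrow> 'c \<Rightarrow> ennreal"
  assumes "countable I" "\<And>i. i \<in> I \<Longrightarrow> g i \<in> borel_measurable M"
  shows "(\<lambda>x. \<integral>\<^sup>+i. g i x \<partial>count_space I) \<in> borel_measurable M"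
proof -
  interpret sigma_finite_measure "count_space I"
    using assms(1) by (rule sigma_finite_measure_count_space_countable)
  have "(\<lambda>(i, x). g i x) \<in> borel_measurable (count_space I \<Otimes>\<^sub>M M)"
    using assms by (intro measurable_pair_measure_countable1) auto
  then have "(\<lambda>(x, i). g i x) \<in> borel_measurable (M \<Otimes>\<^sub>M count_space I)"
    by (drule_tac measurable_pair_swap) simp
  then show ?thesis by (rule borel_measurable_nn_integral)
qed

lemma wmeasure_eq_avg: "Q \<in> cubes \<Longrightarrow> wmeasure w Q = avg Q w * measure lebesgue Q"
  using cubes_measure_pos[of Q] by (simp add: wmeasure_def avg_def)

lemma wmeasure_nonneg: "weight w \<Longrightarrow> wmeasure w E \<ge> 0"
  by (auto simp: wmeasure_def weight_def set_lebesgue_integral_def intro!: integral_nonneg_AE)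

lemma wmeasure_pos:
  assumes "weight w" "AE x in lebesgue. w x > 0" "Q \<in> cubes"
  shows "wmeasure w Q > 0"
proof (rule ccontr)
  assume "\<not> wmeasure w Q > 0"
  then have "(LINT x|lebesgue. indicator Q x *\<^sub>R w x) = 0"
    using wmeasure_nonneg[OF assms(1), of Q] by (simp add: wmeasure_def set_lebesgue_integral_def)
  then have "AE x in lebesgue. indicator Q x *\<^sub>R w x = 0"
    using assms locally_integrable_on_cube[of w Q]
    by (subst (asm) integral_nonneg_eq_0_iff_AE) (auto simp: weight_def set_integrable_def)
  then have "AE x in lebesgue. x \<notin> Q"
    using assms(2) by eventually_elim (auto simp: indicator_def split: if_splits)
  then have "Q \<in> null_sets lebesgue"
    using cubes_lebesgue[OF assms(3)] by (subst AE_iff_null_sets) auto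
  then show False
    using cubes_measure_pos[OF assms(3)] by (simp add: measure_def null_sets_def)
qed

text \<open>Written as an integral over the counting measure, the sum can be exchanged with an
  integral in \<open>x\<close>. The summability clause of \<open>SD_bound\<close> identifies the two
  forms.\<close>

lemma SD_bound_nn_integral_le:
  assumes SD: "SD_bound p s w a C" and w: "weight w" and L: "L > 1" and Q: "Q \<in> cubes"
    and F: "small_family L Q F"
  shows "(\<integral>\<^sup>+R. ennreal (a R powr p * wmeasure w R) \<partial>count_space F)
    \<le> ennreal (C powr p * (1 / L) powr (p / s) * (a Q powr p * wmeasure w Q))"
proof -
  let ?g = "\<lambda>R. a R powr p * wmeasure w R"
  have sum: "?g summable_on F" and le: "infsum ?g F \<le> C powr p * (1 / L) powr (p / s) * a Q powr p * wmeasure w Q"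
    using SD L Q F unfolding SD_bound_def by blast+
  have nonneg: "?g R \<ge> 0" for R using wmeasure_nonneg[OF w] by simp
  have "Infinite_Set_Sum.abs_summable_on ?g F"
    using sum nonneg unfolding abs_summable_equivalent[symmetric] by simp
  then have "(\<integral>\<^sup>+R. ennreal (?g R) \<partial>count_space F) = ennreal (infsum ?g F)"
    using nonneg by (simp add: nn_integral_conv_infsetsum infsetsum_infsum)
  then show ?thesis using le by (simp add: ennreal_leI mult.assoc)
qed

text \<open>
  A constant smaller than 1 could be applied along arbitrarily long increasing chains of
  cubes between two fixed ones, which would make \<open>a\<close> vanish.
\<close>

lemma SD_bound_ge_1:
  fixes w :: "real ^ 'n \<Rightarrow> real"
  assumes SD: "SD_bound p s w a C" and w: "weight w" "AE x in lebesgue. w x > 0"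
    and a: "\<forall>Q\<in>cubes. a Q > 0" and p: "p \<ge> 1" and s: "s > 1"
  shows "C \<ge> 1"
proof (rule ccontr)
  assume "\<not> C \<ge> 1"
  then have C: "0 \<le> C" "C < 1" using SD by (auto simp: SD_bound_def)
  define Q where "Q r = cube (0 :: real ^ 'n) r" for r
  define h where "h r = a (Q r) powr p * wmeasure w (Q r)" for r
  have Q: "Q r \<in> cubes" if "r > 0" for r using that by (auto simp: Q_def cubes_def)
  have h: "h r > 0" if "r > 0" for r
    using bspec[OF a Q[OF that]] wmeasure_pos[OF w Q[OF that]] by (simp add: h_def)
  have step: "h r \<le> C powr p * h r'" if r: "0 < r" "r < r'" for r r'
  proof -
    \<comment> \<open>The volume ratio is the largest \<open>L\<close> for which
      \<open>{Q r}\<close> is \<open>L\<close>-small in \<open>Q r'\<close>.\<close>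
    define L where "L = (r' / r) ^ CARD('n)"
    have L: "L > 1" unfolding L_def using r by (intro one_less_power) auto
    have "Q r \<subseteq> Q r'"
      using r by (auto simp: Q_def cube_def) (meson less_trans)
    moreover have "emeasure lebesgue (Q r) = ennreal (1 / L) * emeasure lebesgue (Q r')"
      using r unfolding Q_def L_def
      by (simp add: emeasure_cube ennreal_mult'[symmetric] power_divide del: emeasure_completion)
    ultimately have "small_family L (Q r') {Q r}"
      using r L Q by (intro small_familyI) (auto simp del: emeasure_completion)
    then have "(\<integral>\<^sup>+R. ennreal (a R powr p * wmeasure w R) \<partial>count_space {Q r})
        \<le> ennreal (C powr p * (1 / L) powr (p / s) * (a (Q r') powr p * wmeasure w (Q r')))"
      using r by (intro SD_bound_nn_integral_le[OF SD w(1) L Q]) auto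
    then have "ennreal (h r) \<le> ennreal (C powr p * (1 / L) powr (p / s) * h r')"
      by (simp add: nn_integral_count_space_finite h_def)
    then have "h r \<le> C powr p * (1 / L) powr (p / s) * h r'"
      using h[of r'] r by (subst (asm) ennreal_le_iff) auto
    also have "(1 / L) powr (p / s) \<le> 1"
      using L p s by (intro powr_le1) auto
    then have "C powr p * (1 / L) powr (p / s) * h r' \<le> C powr p * 1 * h r'"
      using h[of r'] r by (intro mult_right_mono mult_left_mono) auto
    finally show ?thesis by simp
  qed
  define q where "q = C powr p"
  have q: "0 \<le> q" "q < 1"
    using C p powr_less_mono2[of p C 1] by (auto simp: q_def)
  \<comment> \<open>Infinitely many side lengths increasing from 1 and staying below 2: each link of
    the chain contributes a factor \<open>q < 1\<close>, while the outer cube \<open>Q 2\<close> is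
    fixed.\<close>
  define r where "r i = 2 - 1 / (real i + 1)" for i :: nat
  have r: "0 < r i" "r i < r (Suc i)" "r i < 2" for i
    by (simp_all add: r_def field_simps)
  have chain: "h (r 0) \<le> q ^ i * h (r i)" for i
  proof (induction i)
    case (Suc i)
    have "q ^ i * h (r i) \<le> q ^ i * (q * h (r (Suc i)))"
      using q step[OF r(1,2)] by (intro mult_left_mono) (auto simp: q_def)
    then show ?case using Suc by (simp add: mult_ac)
  qed simp
  have "h (r 0) \<le> q ^ i * (q * h 2)" for i
  proof -
    have "q ^ i * h (r i) \<le> q ^ i * (q * h 2)"
      using q step[OF r(1,3)] by (intro mult_left_mono) (auto simp: q_def)
    then show ?thesis using chain[of i] by linarith
  qed
  moreover have "(\<lambda>i. q ^ i * (q * h 2)) \<longlonglongrightarrow> 0 * (q * h 2)"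
    using q by (intro tendsto_intros LIMSEQ_realpow_zero) auto
  ultimately have "h (r 0) \<le> 0"
    using LIMSEQ_le_const[of _ "0 * (q * h 2)" "h (r 0)"] by auto
  then show False using h[OF r(1)[of 0]] by simp
qed

lemma weighted_oscillation_le:
  fixes w f :: "real ^ 'n \<Rightarrow> real"
  assumes w: "weight w" "AE x in lebesgue. w x > 0" and p: "p \<ge> 1" and s: "s > 1"
    and a: "\<forall>Q\<in>cubes. a Q > 0" and SD: "SD_bound p s w a C"
    and f: "locally_integrable f"
    and osc: "\<forall>Q\<in>cubes. avg Q (\<lambda>x. \<bar>f x - avg Q f\<bar>) \<le> a Q"
    and Q: "Q \<in> cubes"
  shows "(\<integral>\<^sup>+x. ennreal (indicator Q x * (\<bar>f x - avg Q f\<bar> powr p * w x)) \<partial>lebesgue)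
    \<le> ennreal ((2 ^ CARD('n) * exp 1 * C / (1 - exp (- 1 / s))) powr p * (a Q powr p * wmeasure w Q))"
proof -
  define L where "L = exp (1 :: real)"
  define t where "t = exp (- 1 / s)"
  \<comment> \<open>One constant for two bounds: the jump of averages from a cube to a selected
    child and, as \<open>L \<le> K\<close>, the oscillation off the children.\<close>
  define K where "K = 2 ^ CARD('n) * L"
  define D where "D = a Q powr p * wmeasure w Q"
  have L: "L > 1" by (simp add: L_def)
  have t: "0 < t" "t < 1" using s by (auto simp: t_def)
  have K: "K \<ge> L" "K > 0" using L by (auto simp: K_def)
  have C: "C \<ge> 1" using SD_bound_ge_1[OF SD w a p s] .
  have D: "D \<ge> 0" using wmeasure_nonneg[OF w(1)] by (simp add: D_def)
  have int: "set_integrable lebesgue R f" if "R \<in> cubes" for R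
    using locally_integrable_on_cube[OF f that] .
  \<comment> \<open>A family is chosen for every cube at once, with \<open>A = a Q\<close>, because
    the selection continues inside every selected cube.\<close>
  have "\<exists>F. \<forall>Q\<in>cubes. F Q \<subseteq> cubes \<and> countable (F Q) \<and> disjoint (F Q) \<and> (\<forall>R\<in>F Q. R \<subseteq> Q) \<and>
    (\<forall>R\<in>F Q. \<bar>avg R f - avg Q f\<bar> \<le> 2 ^ CARD('n) * L * a Q) \<and>
    emeasure lebesgue (\<Union>(F Q)) \<le> ennreal (1 / L) * emeasure lebesgue Q \<and>
    (AE x in lebesgue. x \<in> Q \<longrightarrow> x \<notin> \<Union>(F Q) \<longrightarrow> \<bar>f x - avg Q f\<bar> \<le> L * a Q)" (is "\<exists>F. \<forall>Q\<in>cubes. ?P F Q")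
    by (intro bchoice ballI calderon_zygmund int bspec[OF osc] bspec[OF a] less_imp_le[OF L])
  then obtain F where "\<forall>Q\<in>cubes. ?P F Q" by (elim exE)
  note F = bspec[OF this]
  have F_avg: "\<bar>avg R f - avg Q f\<bar> \<le> K * a Q" if "Q \<in> cubes" "R \<in> F Q" for Q R
    unfolding K_def using F[OF that(1)] that(2) by (elim conjE bspec)
  have F_AE: "AE x in lebesgue. x \<in> Q \<longrightarrow> x \<notin> \<Union>(F Q) \<longrightarrow> \<bar>f x - avg Q f\<bar> \<le> L * a Q"
    if "Q \<in> cubes" for Q
    using F[OF that] by (elim conjE)
  interpret cube_selection F L
  proof (rule cube_selection.intro)
    fix Q :: "(real ^ 'n) set" assume "Q \<in> cubes"
    note FQ = F[OF this]
    show "F Q \<subseteq> cubes" "countable (F Q)" "disjoint (F Q)"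
      "emeasure lebesgue (\<Union>(F Q)) \<le> ennreal (1 / L) * emeasure lebesgue Q"
      using FQ by - (elim conjE, assumption)+
    show "R \<subseteq> Q" if "R \<in> F Q" for R
      using FQ that by (elim conjE) (elim bspec)
  qed (rule L)
  have gen_cubes: "R \<in> cubes" if "R \<in> generation F Q j" for R j
    using that generation_cubes[OF Q] by blast

  define W where "W = density lebesgue (\<lambda>x. ennreal (indicator Q x * w x))"
  have wQ: "set_integrable lebesgue Q w"
    using locally_integrable_on_cube[OF _ Q] w(1) by (simp add: weight_def)
  have wm: "(\<lambda>x. indicator Q x * w x) \<in> borel_measurable lebesgue"
    using wQ borel_measurable_integrable unfolding set_integrable_def by fastforce
  have W_sets: "sets W = sets lebesgue" by (simp add: W_def)
  have W_eq: "emeasure W R = ennreal (wmeasure w R)" if R: "R \<in> generation F Q j" for R j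
  proof -
    have "emeasure W R = ennreal (avg R w) * ennreal (measure lebesgue R)"
      unfolding W_def cubes_emeasure[OF gen_cubes[OF R], symmetric] using w(1)
      by (intro emeasure_density_cube gen_cubes[OF R] generation_subset[OF Q R] Q wQ) (simp add: weight_def)
    then show ?thesis
      by (simp add: wmeasure_eq_avg[OF gen_cubes[OF R]] ennreal_mult'')
  qed

  \<comment> \<open>The p-th power of A_j: the cubes of a generation are disjoint, so at most one
    term is nonzero at each \<open>x\<close> and the power passes to the coefficients.\<close>
  define G where "G j x = (\<integral>\<^sup>+R. ennreal (a R powr p) * indicator R x \<partial>count_space (generation F Q j))" for j x
  have term_meas: "(\<lambda>x. ennreal (a R powr p) * indicator R x) \<in> borel_measurable W"
    if "R \<in> generation F Q j" for R j
    using that generation_sets[OF Q, of j] W_sets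
    by (intro borel_measurable_times_ennreal borel_measurable_indicator) auto
  have G_meas: "G j \<in> borel_measurable W" for j
    unfolding G_def
    by (intro borel_measurable_nn_integral_count_space countable_generation[OF Q] term_meas)
  have G_le: "(\<integral>\<^sup>+x. G j x \<partial>W) \<le> ennreal ((C * t ^ j) powr p * D)" for j
  proof -
    have "(\<integral>\<^sup>+x. G j x \<partial>W) =
        (\<integral>\<^sup>+R. \<integral>\<^sup>+x. ennreal (a R powr p) * indicator R x \<partial>W \<partial>count_space (generation F Q j))"
      unfolding G_def
      by (intro nn_integral_count_space_nn_integral countable_generation[OF Q] term_meas)
    also have "\<dots> = (\<integral>\<^sup>+R. ennreal (a R powr p * wmeasure w R) \<partial>count_space (generation F Q j))"
    proof (rule nn_integral_cong)
      fix R assume "R \<in> space (count_space (generation F Q j))"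
      then have R: "R \<in> generation F Q j" by simp
      then have "R \<in> sets W" using generation_sets[OF Q, of j] W_sets by auto
      then have "(\<integral>\<^sup>+x. ennreal (a R powr p) * indicator R x \<partial>W) = ennreal (a R powr p) * emeasure W R"
        by (rule nn_integral_cmult_indicator)
      then show "(\<integral>\<^sup>+x. ennreal (a R powr p) * indicator R x \<partial>W) = ennreal (a R powr p * wmeasure w R)"
        by (simp add: W_eq[OF R] ennreal_mult')
    qed
    also have "\<dots> \<le> ennreal ((C * t ^ j) powr p * D)"
    \<comment> \<open>Generation 0 would need the SD condition at \<open>L ^ 0 = 1\<close>, which
      lies outside its range; there \<open>C \<ge> 1\<close> suffices.\<close>
    proof (cases "j = 0")
      case True
      have "1 \<le> C powr p" using C p by (intro ge_one_powr_ge_zero) auto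
      then have "D \<le> (C * t ^ j) powr p * D"
        using True D mult_right_mono[of 1 "C powr p" D] by simp
      then show ?thesis
        using True by (simp add: nn_integral_count_space_finite D_def ennreal_leI)
    next
      case False
      have "(1 / L ^ j) powr (p / s) = exp (real j * (- p / s))"
        by (simp add: L_def exp_of_nat_mult[symmetric] powr_def ln_div)
      also have "\<dots> = (t ^ j) powr p"
        by (simp add: t_def exp_of_nat_mult[symmetric] powr_def)
      finally have e: "(1 / L ^ j) powr (p / s) = (t ^ j) powr p" .
      have "L ^ j > 1" using L False by simp
      from SD_bound_nn_integral_le[OF SD w(1) this Q small_family_generation[OF Q]]
      show ?thesis using C t by (simp add: e D_def powr_mult)
    qed
    finally show ?thesis .
  qed

  have pointwise: "AE x in lebesgue. x \<in> Q \<longrightarrow> ennreal (\<bar>f x - avg Q f\<bar> powr p)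
      \<le> (\<Sum>j. ennreal (K powr p * (t ^ j * (1 - t)) powr (1 - p)) * G j x)"
  proof -
    \<comment> \<open>All generations together contain countably many cubes, so their exceptional
      null sets unite into one.\<close>
    have "AE x in lebesgue. \<forall>j. \<forall>R\<in>generation F Q j.
        x \<in> R \<longrightarrow> x \<notin> \<Union>(F R) \<longrightarrow> \<bar>f x - avg R f\<bar> \<le> L * a R"
      using countable_generation[OF Q] F_AE gen_cubes
      by (simp add: AE_all_countable AE_ball_countable)
    then show ?thesis
      using AE_not_in_all_generations[OF Q]
    proof (eventually_elim, intro impI)
      case (elim x)
      assume x: "x \<in> Q"
      obtain k where "x \<notin> \<Union>(generation F Q k)" using elim(2) by blast
      then obtain m r where r: "r 0 = Q" "\<And>j. j \<le> m \<Longrightarrow> r j \<in> generation F Q j"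
          "\<And>j. j < m \<Longrightarrow> r (Suc j) \<in> F (r j)" "x \<notin> \<Union>(F (r m))" and r_mem: "\<And>j. j \<le> m \<Longrightarrow> x \<in> r j"
        using generation_chain[OF Q x] by metis
      have ar: "a (r j) > 0" if "j \<le> m" for j using a gen_cubes r(2)[OF that] by blast
      have "\<bar>avg (r j) f - avg Q f\<bar> \<le> (\<Sum>i<j. K * a (r i))" if "j \<le> m" for j
        using that
      proof (induction j)
        case (Suc j)
        have "\<bar>avg (r (Suc j)) f - avg (r j) f\<bar> \<le> K * a (r j)"
          using Suc.prems r(2)[of j] r(3)[of j] by (intro F_avg gen_cubes) auto
        then show ?case using Suc by simp
      qed (simp add: r(1))
      from this[of m] have "\<bar>avg (r m) f - avg Q f\<bar> \<le> (\<Sum>i<m. K * a (r i))" by simp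
      moreover have "\<bar>f x - avg (r m) f\<bar> \<le> L * a (r m)"
        using elim(1) r(2)[of m] r_mem[of m] r(4) by blast
      moreover have "L * a (r m) \<le> K * a (r m)"
        using K ar[of m] by (intro mult_right_mono) auto
      ultimately have "\<bar>f x - avg Q f\<bar> \<le> K * (\<Sum>j\<le>m. a (r j))"
        by (simp add: lessThan_Suc_atMost[symmetric] sum_distrib_left distrib_left)
      then have "\<bar>f x - avg Q f\<bar> powr p \<le> (K * (\<Sum>j\<le>m. a (r j))) powr p"
        using p by (intro powr_mono2) auto
      also have "\<dots> = K powr p * (\<Sum>j\<le>m. a (r j)) powr p"
        by (rule powr_mult)
      also have "\<dots> \<le> K powr p * (\<Sum>j\<le>m. (t ^ j * (1 - t)) powr (1 - p) * a (r j) powr p)"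
        using t p ar by (intro mult_left_mono powr_sum_le_geometric) auto
      finally have "ennreal (\<bar>f x - avg Q f\<bar> powr p)
          \<le> ennreal (\<Sum>j\<le>m. K powr p * (t ^ j * (1 - t)) powr (1 - p) * a (r j) powr p)"
        by (simp add: sum_distrib_left mult.assoc ennreal_leI)
      also have "\<dots> = (\<Sum>j\<le>m. ennreal (K powr p * (t ^ j * (1 - t)) powr (1 - p)) * ennreal (a (r j) powr p))"
        by (subst sum_ennreal[symmetric]) (auto simp: ennreal_mult')
      also have "\<dots> \<le> (\<Sum>j\<le>m. ennreal (K powr p * (t ^ j * (1 - t)) powr (1 - p)) * G j x)"
      proof (intro sum_mono mult_left_mono)
        fix j assume j: "j \<in> {..m}"
        then have "x \<in> r j" using r_mem by simp
        then show "ennreal (a (r j) powr p) \<le> G j x"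
          using nn_integral_count_space_ge[OF r(2), of j "\<lambda>R. ennreal (a R powr p) * indicator R x"] j
          by (simp add: G_def)
      qed simp
      \<comment> \<open>The chain length \<open>m\<close> depends on \<open>x\<close>; the full
        series is a bound free of it, which can be integrated term by term.\<close>
      also have "\<dots> \<le> (\<Sum>j. ennreal (K powr p * (t ^ j * (1 - t)) powr (1 - p)) * G j x)"
        by (intro sum_le_suminf) auto
      finally show "ennreal (\<bar>f x - avg Q f\<bar> powr p)
          \<le> (\<Sum>j. ennreal (K powr p * (t ^ j * (1 - t)) powr (1 - p)) * G j x)" .
    qed
  qed

  have "(\<integral>\<^sup>+x. ennreal (indicator Q x * (\<bar>f x - avg Q f\<bar> powr p * w x)) \<partial>lebesgue)
      \<le> (\<integral>\<^sup>+x. ennreal (indicator Q x * w x) *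
          (\<Sum>j. ennreal (K powr p * (t ^ j * (1 - t)) powr (1 - p)) * G j x) \<partial>lebesgue)"
  proof (rule nn_integral_mono_AE, rule AE_mp[OF pointwise], intro AE_I2 impI)
    fix x assume elim: "x \<in> Q \<longrightarrow> ennreal (\<bar>f x - avg Q f\<bar> powr p)
      \<le> (\<Sum>j. ennreal (K powr p * (t ^ j * (1 - t)) powr (1 - p)) * G j x)"
    show "ennreal (indicator Q x * (\<bar>f x - avg Q f\<bar> powr p * w x)) \<le> ennreal (indicator Q x * w x) *
          (\<Sum>j. ennreal (K powr p * (t ^ j * (1 - t)) powr (1 - p)) * G j x)"
    proof (cases "x \<in> Q")
      case True
      have "ennreal (indicator Q x * (\<bar>f x - avg Q f\<bar> powr p * w x))
          = ennreal (indicator Q x * w x) * ennreal (\<bar>f x - avg Q f\<bar> powr p)"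
        using True by (simp add: mult.commute ennreal_mult'')
      also have "\<dots> \<le> ennreal (indicator Q x * w x) *
          (\<Sum>j. ennreal (K powr p * (t ^ j * (1 - t)) powr (1 - p)) * G j x)"
        using elim True by (intro mult_left_mono) auto
      finally show ?thesis .
    qed simp
  qed
  also have "\<dots> = (\<integral>\<^sup>+x. (\<Sum>j. ennreal (K powr p * (t ^ j * (1 - t)) powr (1 - p)) * G j x) \<partial>W)"
    unfolding W_def using wm G_meas
    by (intro nn_integral_density[symmetric] borel_measurable_suminf borel_measurable_times_ennreal) (auto simp: W_def)
  also have "\<dots> = (\<Sum>j. \<integral>\<^sup>+x. ennreal (K powr p * (t ^ j * (1 - t)) powr (1 - p)) * G j x \<partial>W)"
    using G_meas by (intro nn_integral_suminf borel_measurable_times_ennreal) auto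
  also have "\<dots> = (\<Sum>j. ennreal (K powr p * (t ^ j * (1 - t)) powr (1 - p)) * (\<integral>\<^sup>+x. G j x \<partial>W))"
    by (intro suminf_cong nn_integral_cmult G_meas)
  also have "\<dots> \<le> (\<Sum>j. ennreal (K powr p * (t ^ j * (1 - t)) powr (1 - p)) * ennreal ((C * t ^ j) powr p * D))"
    by (intro suminf_le mult_left_mono G_le) auto
  also have "\<dots> = (\<Sum>j. ennreal (t ^ j * (K powr p * C powr p * (1 - t) powr (1 - p) * D)))"
  proof (rule suminf_cong)
    fix j
    \<comment> \<open>The exponents \<open>1 - p\<close> and \<open>p\<close> add up to 1, which
      leaves a geometric series of ratio \<open>t\<close> whatever \<open>p\<close> is.\<close>
    have "(t ^ j) powr (1 - p) * (t ^ j) powr p = t ^ j"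
      using t by (simp add: powr_add[symmetric])
    then have "K powr p * (t ^ j * (1 - t)) powr (1 - p) * ((C * t ^ j) powr p * D)
        = t ^ j * (K powr p * C powr p * (1 - t) powr (1 - p) * D)"
      using t C by (simp add: powr_mult)
    moreover have "K powr p * (t ^ j * (1 - t)) powr (1 - p) \<ge> 0" by simp
    ultimately show "ennreal (K powr p * (t ^ j * (1 - t)) powr (1 - p)) * ennreal ((C * t ^ j) powr p * D)
        = ennreal (t ^ j * (K powr p * C powr p * (1 - t) powr (1 - p) * D))"
      by (simp only: ennreal_mult'[symmetric])
  qed
  also have "\<dots> = ennreal (1 / (1 - t) * (K powr p * C powr p * (1 - t) powr (1 - p) * D))"
    using t D by (intro suminf_ennreal_eq sums_mult2 geometric_sums) auto
  \<comment> \<open>The sum of the series completes \<open>(1 - t) powr (1 - p)\<close> to a p-th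
    power, so the later root produces a constant without \<open>p\<close>.\<close>
  also have "1 / (1 - t) * (K powr p * C powr p * (1 - t) powr (1 - p) * D) = (K * C / (1 - t)) powr p * D"
    using t C K by (simp add: powr_mult powr_divide powr_diff)
  finally show ?thesis
    by (simp add: K_def L_def t_def D_def)
qed

text \<open>From e^(1/s) >= 1 + 1/s follows 1 - e^(-1/s) >= 1/(s + 1) >= 1/(2s). This is the source
  of the linear factor \<open>s\<close>.\<close>

lemma inverse_one_minus_exp_le:
  fixes s :: real
  assumes "s \<ge> 1"
  shows "1 / (1 - exp (- 1 / s)) \<le> 2 * s"
proof -
  have "1 + 1 / s \<le> exp (1 / s)" by (rule exp_ge_add_one_self)
  then have "exp (- 1 / s) \<le> 1 / (1 + 1 / s)"
    using assms by (simp add: exp_minus inverse_eq_divide frac_le add_pos_pos)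
  also have "1 / (1 + 1 / s) = 1 - 1 / (s + 1)" using assms by (simp add: field_simps)
  also have "\<dots> \<le> 1 - 1 / (2 * s)" using assms by (intro diff_mono divide_left_mono) auto
  finally have "1 / (2 * s) \<le> 1 - exp (- 1 / s)" by simp
  then have "1 / (1 - exp (- 1 / s)) \<le> 1 / (1 / (2 * s))"
    using assms by (intro divide_left_mono) (auto intro!: mult_pos_pos)
  then show ?thesis by simp
qed

text \<open>Finiteness of the nonnegative integral gives integrability first; otherwise the Bochner
  integral in the second claim could be the default 0.\<close>

lemma weighted_oscillation_root_le:
  fixes w f :: "real ^ 'n \<Rightarrow> real"
  assumes w: "weight w" "AE x in lebesgue. w x > 0" and p: "p \<ge> 1" and s: "s > 1"
    and a: "\<forall>Q\<in>cubes. a Q > 0" and SD: "SD_bound p s w a C"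
    and f: "locally_integrable f"
    and osc: "\<forall>Q\<in>cubes. avg Q (\<lambda>x. \<bar>f x - avg Q f\<bar>) \<le> a Q"
    and Q: "Q \<in> cubes"
  shows "set_integrable lebesgue Q (\<lambda>x. \<bar>f x - avg Q f\<bar> powr p * w x)"
    and "(1 / wmeasure w Q * (LINT x:Q|lebesgue. \<bar>f x - avg Q f\<bar> powr p * w x)) powr (1 / p)
      \<le> 2 * 2 ^ CARD('n) * exp 1 * s * C * a Q"
proof -
  define h where "h x = indicator Q x * (\<bar>f x - avg Q f\<bar> powr p * w x)" for x
  define K where "K = 2 ^ CARD('n) * exp 1 * C / (1 - exp (- 1 / s))"
  have C: "C \<ge> 1" using SD_bound_ge_1[OF SD w a p s] .
  have K: "K \<ge> 0" using C s by (simp add: K_def)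
  have aQ: "a Q > 0" and wQ: "wmeasure w Q > 0" using a Q wmeasure_pos[OF w Q] by auto
  have fm: "(\<lambda>x. indicator Q x * f x) \<in> borel_measurable lebesgue"
    using locally_integrable_on_cube[OF f Q] borel_measurable_integrable
    unfolding set_integrable_def by fastforce
  have wm: "(\<lambda>x. indicator Q x * w x) \<in> borel_measurable lebesgue"
    using locally_integrable_on_cube[OF _ Q, of w] w(1) borel_measurable_integrable
    unfolding set_integrable_def weight_def by fastforce
  \<comment> \<open>\<open>f\<close> and \<open>w\<close> are made to occur only multiplied by the
    indicator, the form in which \<open>fm\<close> and \<open>wm\<close> give measurability.\<close>
  have "h = (\<lambda>x. \<bar>indicator Q x * f x - indicator Q x * avg Q f\<bar> powr p * (indicator Q x * w x))"
    by (auto simp: h_def indicator_def fun_eq_iff)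
  also have "\<dots> \<in> borel_measurable lebesgue"
    using cubes_lebesgue[OF Q]
    by (intro borel_measurable_times powr_real_measurable borel_measurable_abs borel_measurable_diff fm wm) auto
  finally have hm: "h \<in> borel_measurable lebesgue" .
  have h0: "h x \<ge> 0" for x using w(1) by (simp add: h_def weight_def)
  have le: "(\<integral>\<^sup>+x. ennreal (h x) \<partial>lebesgue) \<le> ennreal (K powr p * (a Q powr p * wmeasure w Q))"
    using weighted_oscillation_le[OF w p s a SD f osc Q] by (simp add: h_def K_def)
  have hi: "integrable lebesgue h"
    using hm h0 le by (intro integrableI_nonneg) (auto intro: le_less_trans)
  then show "set_integrable lebesgue Q (\<lambda>x. \<bar>f x - avg Q f\<bar> powr p * w x)"
    by (simp add: set_integrable_def h_def[abs_def])
  have "(\<integral>\<^sup>+x. ennreal (h x) \<partial>lebesgue) = ennreal (LINT x|lebesgue. h x)"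
    using hi h0 by (intro nn_integral_eq_integral) auto
  then have "(LINT x|lebesgue. h x) \<le> K powr p * (a Q powr p * wmeasure w Q)"
    using le wQ by (simp add: ennreal_le_iff)
  then have "1 / wmeasure w Q * (LINT x|lebesgue. h x) \<le> (K * a Q) powr p"
    using wQ K aQ by (simp add: powr_mult field_simps)
  then have "(1 / wmeasure w Q * (LINT x|lebesgue. h x)) powr (1 / p) \<le> ((K * a Q) powr p) powr (1 / p)"
    using wQ p h0 by (intro powr_mono2) (auto intro!: mult_nonneg_nonneg integral_nonneg_AE)
  also have "\<dots> = K * a Q"
    using p K aQ by (simp add: powr_powr)
  also have "K = 2 ^ CARD('n) * exp 1 * C * (1 / (1 - exp (- 1 / s)))"
    by (simp add: K_def)
  also have "\<dots> * a Q \<le> 2 ^ CARD('n) * exp 1 * C * (2 * s) * a Q"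
    using inverse_one_minus_exp_le[of s] s C aQ by (intro mult_right_mono mult_left_mono) auto
  finally show "(1 / wmeasure w Q * (LINT x:Q|lebesgue. \<bar>f x - avg Q f\<bar> powr p * w x)) powr (1 / p)
      \<le> 2 * 2 ^ CARD('n) * exp 1 * s * C * a Q"
    by (simp add: set_lebesgue_integral_def h_def[abs_def] mult_ac)
qed

theorem theorem1p5:
  shows "\<exists>C>0. \<forall>(w :: real ^ 'n \<Rightarrow> real) (p :: real) (s :: real)
            (a :: (real ^ 'n) set \<Rightarrow> real) (f :: real ^ 'n \<Rightarrow> real).
          A_infinity w \<longrightarrow> p \<ge> 1 \<longrightarrow> s > 1 \<longrightarrow>
          (\<forall>Q\<in>cubes. a Q > 0) \<longrightarrow> SD p s w a \<longrightarrow>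
          locally_integrable f \<longrightarrow>
          (\<forall>Q\<in>cubes. avg Q (\<lambda>x. \<bar>f x - avg Q f\<bar>) \<le> a Q) \<longrightarrow>
          (\<forall>Q\<in>cubes.
             set_integrable lebesgue Q (\<lambda>x. \<bar>f x - avg Q f\<bar> powr p * w x) \<and>
             (1 / wmeasure w Q * (LINT x:Q|lebesgue. \<bar>f x - avg Q f\<bar> powr p * w x)) powr (1 / p)
               \<le> C * s * SD_norm p s w a powr s * a Q)"
proof (intro exI[of _ "2 * 2 ^ CARD('n) * exp 1"] conjI allI impI ballI)
  fix w f :: "real ^ 'n \<Rightarrow> real" and p s :: real and a :: "(real ^ 'n) set \<Rightarrow> real" and Q :: "(real ^ 'n) set"
  assume Ai: "A_infinity w" and p: "p \<ge> 1" and s: "s > 1" and a: "\<forall>Q\<in>cubes. a Q > 0"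
    and SD: "SD p s w a" and f: "locally_integrable f"
    and osc: "\<forall>Q\<in>cubes. avg Q (\<lambda>x. \<bar>f x - avg Q f\<bar>) \<le> a Q" and Q: "Q \<in> cubes"
  \<comment> \<open>Here e is the height of the decomposition, 2^n the volume ratio of parent to
    child, and the remaining 2 comes from \<open>inverse_one_minus_exp_le\<close>.\<close>
  define K where "K = 2 * 2 ^ CARD('n) * exp (1 :: real)"
  define X where "X = (1 / wmeasure w Q * (LINT x:Q|lebesgue. \<bar>f x - avg Q f\<bar> powr p * w x)) powr (1 / p)"
  have w: "weight w" "AE x in lebesgue. w x > 0"
    using Ai by (auto simp: A_infinity_def Muckenhoupt_def)
  obtain C where C: "SD_bound p s w a C" using SD by (auto simp: SD_def)
  note est = weighted_oscillation_root_le[OF w p s a _ f osc Q]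
  show "set_integrable lebesgue Q (\<lambda>x. \<bar>f x - avg Q f\<bar> powr p * w x)"
    by (rule est(1)[OF C])
  have pos: "K * s * a Q > 0" using s a Q by (simp add: K_def)
  \<comment> \<open>The estimate holds for each admissible constant, so the quotient is a lower
    bound of all of them and hence of their infimum, attained or not.\<close>
  have "X / (K * s * a Q) \<le> SD_norm p s w a"
    unfolding SD_norm_def
  proof (rule cInf_greatest)
    fix B assume "B \<in> {C. SD_bound p s w a C}"
    then have "X \<le> K * s * B * a Q" unfolding X_def K_def by (intro est(2)) simp
    then show "X / (K * s * a Q) \<le> B" using pos by (simp add: pos_divide_le_eq mult_ac)
  qed (use C in blast)
  then have X: "X \<le> K * s * a Q * SD_norm p s w a"
    using pos by (simp add: pos_divide_le_eq mult_ac)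
  \<comment> \<open>Every admissible constant is at least 1, so raising the norm to the power
    \<open>s > 1\<close> does not decrease it.\<close>
  have "1 \<le> SD_norm p s w a"
    unfolding SD_norm_def using C SD_bound_ge_1[OF _ w a p s] by (intro cInf_greatest) auto
  then have "SD_norm p s w a \<le> SD_norm p s w a powr s"
    using powr_mono[of 1 s "SD_norm p s w a"] s by simp
  with X have "X \<le> K * s * a Q * SD_norm p s w a powr s"
    using pos by (meson mult_left_mono less_imp_le order_trans)
  then show "(1 / wmeasure w Q * (LINT x:Q|lebesgue. \<bar>f x - avg Q f\<bar> powr p * w x)) powr (1 / p)
      \<le> 2 * 2 ^ CARD('n) * exp 1 * s * SD_norm p s w a powr s * a Q"
    by (simp add: X_def K_def mult_ac)
qed simp

end
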